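(* Let $G$ be a finite simple graph that is $(P_8,C_5,\text{bull})$-free, i.e. $G$ contains no induced subgraph isomorphic to the path $P_8$ on 8 vertices, the cycle $C_5$, or the bull. Then $G$ is perfectly divisible.
   Context: The bull is the graph consisting of a triangle together with two pendant edges attached at two distinct vertices of the triangle. A graph is perfect if $\chi(H)=\omega(H)$ for every induced subgraph $H$. A graph $G$ is perfectly divisible if for every induced subgraph $H$ of $G$, $V(H)$ can be partitioned into sets $A$ and $B$ such that $H[A]$ is perfect and $\omega(H[B])<\omega(H)$. *)

theory Defs
  imports "Graph_Theory.Graph_Theory"
begin

text \<open>
  Finite simple graphs are the symmetric digraphs of the locale \<^locale>\<open>graph\<close> (finitely many
  vertices and arcs, no loops, no parallel arcs); \<open>u \<rightarrow>\<^bsub>G\<^esub> v\<close> is adjacency in \<open>G\<close>.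
\<close>

definition undirected :: "'a set \<Rightarrow> 'a rel \<Rightarrow> ('a, 'a \<times> 'a) pre_digraph" where
  "undirected V F = with_proj \<lparr> pverts = V, parcs = F \<union> F\<inverse> \<rparr>"

definition path_graph :: "nat \<Rightarrow> (nat, nat \<times> nat) pre_digraph" where
  "path_graph n = undirected {..<n} {(i, Suc i) | i. Suc i < n}"

text \<open>This is the cycle on \<open>n\<close> vertices only for \<open>n \<ge> 3\<close>.\<close>

definition cycle_graph :: "nat \<Rightarrow> (nat, nat \<times> nat) pre_digraph" where
  "cycle_graph n = undirected {..<n} {(i, Suc i mod n) | i. i < n}"

definition bull :: "(nat, nat \<times> nat) pre_digraph" where
  "bull = undirected {..<5} {(0, 1), (1, 2), (2, 0), (0, 3), (1, 4)}"

definition induced_free :: "('c, 'd) pre_digraph \<Rightarrow> ('a, 'b) pre_digraph \<Rightarrow> bool" where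
  "induced_free F G \<longleftrightarrow> \<not> (\<exists>H. induced_subgraph H G \<and> digraph_iso H F)"

definition clique :: "('a, 'b) pre_digraph \<Rightarrow> 'a set \<Rightarrow> bool" where
  "clique G K \<longleftrightarrow> K \<subseteq> verts G \<and> (\<forall>u\<in>K. \<forall>v\<in>K. u \<noteq> v \<longrightarrow> u \<rightarrow>\<^bsub>G\<^esub> v)"

text \<open>The empty set is a clique, so the clique number of the null graph is \<open>0\<close>.\<close>

definition clique_number :: "('a, 'b) pre_digraph \<Rightarrow> nat" where
  "clique_number G = Max {card K | K. clique G K}"

definition proper_coloring :: "('a, 'b) pre_digraph \<Rightarrow> nat \<Rightarrow> ('a \<Rightarrow> nat) \<Rightarrow> bool" where
  "proper_coloring G k c \<longleftrightarrow>
     c ` verts G \<subseteq> {..<k} \<and> (\<forall>u\<in>verts G. \<forall>v\<in>verts G. u \<rightarrow>\<^bsub>G\<^esub> v \<longrightarrow> c u \<noteq> c v)"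

definition chromatic_number :: "('a, 'b) pre_digraph \<Rightarrow> nat" where
  "chromatic_number G = (LEAST k. \<exists>c. proper_coloring G k c)"

definition perfect :: "('a, 'b) pre_digraph \<Rightarrow> bool" where
  "perfect G \<longleftrightarrow> (\<forall>H. induced_subgraph H G \<longrightarrow> chromatic_number H = clique_number H)"

text \<open>
  \<open>H\<close> ranges over the induced subgraphs with at least one vertex: for the null graph no set \<open>B\<close>
  could satisfy the strict inequality. Either part of the partition may be empty.
\<close>

definition perfectly_divisible :: "('a, 'b) pre_digraph \<Rightarrow> bool" where
  "perfectly_divisible G \<longleftrightarrow>
     (\<forall>H. induced_subgraph H G \<and> verts H \<noteq> {} \<longrightarrow>
       (\<exists>A B. A \<union> B = verts H \<and> A \<inter> B = {} \<and>
          perfect (H \<restriction> A) \<and> clique_number (H \<restriction> B) < clique_number H))"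

end

theory Submission
  imports Defs
begin

text \<open>
  By induction over graphs with positive vertex weights, a homogeneous set can be contracted to a
  single vertex, so the graph \<open>G\<close> may be assumed prime. For a vertex \<open>v\<close> of maximum degree, the
  vertices not adjacent to \<open>v\<close> then induce a perfect graph, and removing them leaves neighbors
  of \<open>v\<close> only, where the clique number is smaller.

  Otherwise there is a minimal imperfect \<open>F\<close> anticomplete to \<open>v\<close>. As \<open>G\<close> is prime, some vertex \<open>n\<close>
  outside \<open>F\<close> has a neighbor anticomplete to \<open>F\<close> and is mixed on \<open>F\<close>, and as \<open>F\<close> is prime and \<open>G\<close>
  bull-free, the set \<open>S\<close> of neighbors of \<open>n\<close> in \<open>F\<close> is stable. If \<open>F\<close> contains a triangle, let \<open>Q\<close> be a
  nontrivial component of the neighborhood in \<open>F\<close> of some \<open>s \<in> S\<close>. It is not homogeneous in \<open>F\<close>, but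
  only vertices of \<open>S\<close> can be mixed on it; such a vertex forms an even pair with \<open>s\<close>, which is
  impossible in a minimal imperfect graph. If \<open>F\<close> is triangle-free, it contains a cycle \<open>C\<^sub>7\<close>. The
  attachments of the other vertices to this \<open>C\<^sub>7\<close> show that some vertex of the \<open>C\<^sub>7\<close> is adjacent to
  all the neighbors of \<open>v\<close> and to a further vertex, contradicting the choice of \<open>v\<close>.
\<close>

section \<open>Minimal imperfect graphs\<close>

text \<open>Weights make contraction lossless: the vertex that replaces a homogeneous set receives
  the largest weight of a clique inside that set. They stay positive, so that adding the vertex of
  maximum degree to a clique of its neighbors is a strict gain.

  Minimal imperfect graphs enter mainly through two things they cannot contain: a proper homogeneous
  set and an even pair. The second is linear algebra: Gasparian's rank argument gives at least
  \<open>\<alpha> * k + 1\<close> vertices, a coloring shows that there are no more, and for an even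
  pair \<open>x\<close>, \<open>y\<close> the rank argument would already apply to
  \<open>F - {y}\<close>.

  The forbidden graphs share the work. Bulls exclude vertices that are mixed on an edge of certain
  neighborhoods; \<open>P_8\<close> leaves only the lengths 1, 3, 5 for odd induced paths, and
  \<open>C_5\<close> disposes of length 3. This is also the origin of the 7: an induced path of
  length 5 closed by one vertex. The degree condition is there because the triangle-free case is not
  contradictory by itself; it only yields a vertex whose neighborhood strictly contains that of
  \<open>v\<close>.\<close>

locale simple_graph =
  fixes E :: "'a \<Rightarrow> 'a \<Rightarrow> bool"  (infix "\<sim>" 50)
  assumes sym: "u \<sim> v \<Longrightarrow> v \<sim> u" and irrefl: "\<not> u \<sim> u"
begin

definition clq :: "'a set \<Rightarrow> bool" where
  "clq K \<longleftrightarrow> (\<forall>u\<in>K. \<forall>v\<in>K. u \<noteq> v \<longrightarrow> u \<sim> v)"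

definition stable :: "'a set \<Rightarrow> bool" where
  "stable S \<longleftrightarrow> (\<forall>u\<in>S. \<forall>v\<in>S. \<not> u \<sim> v)"

definition coloring :: "'a set \<Rightarrow> nat \<Rightarrow> ('a \<Rightarrow> nat) \<Rightarrow> bool" where
  "coloring V k c \<longleftrightarrow> (\<forall>v\<in>V. c v < k) \<and> (\<forall>u\<in>V. \<forall>v\<in>V. u \<sim> v \<longrightarrow> c u \<noteq> c v)"

definition colorable :: "'a set \<Rightarrow> nat \<Rightarrow> bool" where
  "colorable V k \<longleftrightarrow> (\<exists>c. coloring V k c)"

text \<open>For finite \<open>V\<close> the least admissible \<open>k\<close> is the clique number
  of \<open>U\<close>, so this demands that the chromatic number of \<open>U\<close> be at most its
  clique number; the reverse inequality always holds.\<close>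

definition perfect_on :: "'a set \<Rightarrow> bool" where
  "perfect_on V \<longleftrightarrow> (\<forall>U k. U \<subseteq> V \<and> (\<forall>K\<subseteq>U. clq K \<longrightarrow> card K \<le> k) \<longrightarrow> colorable U k)"

definition min_imperfect :: "'a set \<Rightarrow> bool" where
  "min_imperfect F \<longleftrightarrow> finite F \<and> \<not> perfect_on F \<and> (\<forall>U. U \<subset> F \<longrightarrow> perfect_on U)"

definition homogeneous :: "'a set \<Rightarrow> 'a set \<Rightarrow> bool" where
  "homogeneous X V \<longleftrightarrow> X \<subseteq> V \<and> (\<forall>w\<in>V - X. (\<forall>x\<in>X. w \<sim> x) \<or> (\<forall>x\<in>X. \<not> w \<sim> x))"

definition prime_on :: "'a set \<Rightarrow> bool" where
  "prime_on V \<longleftrightarrow> (\<forall>X. homogeneous X V \<and> 2 \<le> card X \<longrightarrow> X = V)"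

lemma clq_mono: "clq K \<Longrightarrow> L \<subseteq> K \<Longrightarrow> clq L"
  by (auto simp: clq_def)

lemma perfect_on_mono: "perfect_on V \<Longrightarrow> U \<subseteq> V \<Longrightarrow> perfect_on U"
  unfolding perfect_on_def by (meson order_trans)

lemma coloring_inj_on_clq:
  assumes "coloring V k c" "K \<subseteq> V" "clq K"
  shows "inj_on c K"
  using assms unfolding coloring_def clq_def inj_on_def by blast

lemma coloring_add_class:
  assumes "coloring U k c" "stable T"
  shows "coloring (U \<union> T) (Suc k) (\<lambda>v. if v \<in> T then k else c v)"
  using assms unfolding coloring_def stable_def
  by (auto simp: less_Suc_eq)

lemma not_perfect_imp_min_imperfect:
  assumes "finite V" "\<not> perfect_on V"
  obtains F where "F \<subseteq> V" "min_imperfect F"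
proof -
  let ?P = "\<lambda>n. \<exists>F\<subseteq>V. \<not> perfect_on F \<and> card F = n"
  have "?P (card V)" using assms by auto
  then have "?P (LEAST n. ?P n)" by (rule LeastI)
  then obtain F where F: "F \<subseteq> V" "\<not> perfect_on F" "card F = (LEAST n. ?P n)" by blast
  have "min_imperfect F"
    unfolding min_imperfect_def
  proof (intro conjI allI impI)
    show "finite F" using F(1) assms(1) finite_subset by blast
    fix U assume U: "U \<subset> F"
    then have "card U < card F" using \<open>finite F\<close> by (simp add: psubset_card_mono)
    then show "perfect_on U" using F U not_less_Least[of "card U" ?P] by auto
  qed (use F in auto)
  with F that show ?thesis by blast
qed

text \<open>A set \<open>U\<close> witnessing imperfection is itself imperfect, so minimality forces
  \<open>U = F\<close>. The resulting \<open>k\<close> is the clique number of \<open>F\<close>: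
  \<open>mi_clique_avoiding\<close> shows that it is attained.\<close>

lemma min_imperfectE:
  assumes "min_imperfect F"
  obtains k where "\<And>K. K \<subseteq> F \<Longrightarrow> clq K \<Longrightarrow> card K \<le> k" "\<not> colorable F k"
proof -
  from assms obtain U k where U: "U \<subseteq> F" "\<forall>K\<subseteq>U. clq K \<longrightarrow> card K \<le> k" "\<not> colorable U k"
    unfolding min_imperfect_def perfect_on_def by blast
  then have "\<not> perfect_on U" unfolding perfect_on_def by blast
  then have "U = F" using assms U(1) unfolding min_imperfect_def by blast
  with U that show ?thesis by blast
qed

section \<open>Cliques, twins and homogeneous sets in a minimal imperfect graph\<close>

context
  fixes F k
  assumes mi: "min_imperfect F"
    and bound: "\<And>K. K \<subseteq> F \<Longrightarrow> clq K \<Longrightarrow> card K \<le> k"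
    and ncol: "\<not> colorable F k"
begin

lemma mi_finite: "finite F"
  using mi by (simp add: min_imperfect_def)

lemma mi_colorable:
  assumes "U \<subset> F" "\<And>K. K \<subseteq> U \<Longrightarrow> clq K \<Longrightarrow> card K \<le> j"
  shows "colorable U j"
  using assms mi unfolding min_imperfect_def perfect_on_def by blast

lemma mi_colorable_proper: "U \<subset> F \<Longrightarrow> colorable U k"
  using bound by (intro mi_colorable) auto

lemma mi_nonempty: "F \<noteq> {}"
  using ncol by (auto simp: colorable_def coloring_def)

lemma mi_pos: "0 < k"
proof -
  obtain v where "v \<in> F" using mi_nonempty by blast
  then have "card {v} \<le> k" by (intro bound) (auto simp: clq_def)
  then show ?thesis by simp
qed

text \<open>If all cliques of \<open>F - T\<close> had fewer than \<open>k\<close> vertices,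
  minimality would color \<open>F - T\<close> with \<open>k - 1\<close> colors, and \<open>T\<close>
  could serve as one more class.\<close>

lemma mi_clique_avoiding:
  assumes "stable T" "T \<subseteq> F"
  obtains K where "K \<subseteq> F - T" "clq K" "card K = k"
proof -
  obtain v where v: "v \<in> F" using mi_nonempty by blast
  \<comment> \<open>An empty \<open>T\<close> is enlarged to a single vertex, since minimality only
    speaks of proper subsets of \<open>F\<close>.\<close>
  define T' where "T' = (if T = {} then {v} else T)"
  have T': "stable T'" "T' \<subseteq> F" "T' \<noteq> {}" "T \<subseteq> T'"
    using assms v by (auto simp: T'_def stable_def irrefl)
  have "\<exists>K\<subseteq>F - T'. clq K \<and> card K = k"
  proof (rule ccontr)
    assume no: "\<not> ?thesis"
    have "colorable (F - T') (k - 1)"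
    proof (rule mi_colorable)
      show "F - T' \<subset> F" using T' by blast
      fix K assume "K \<subseteq> F - T'" "clq K"
      then show "card K \<le> k - 1" using no bound[of K] by fastforce
    qed
    then obtain c where "coloring (F - T') (k - 1) c" by (auto simp: colorable_def)
    from coloring_add_class[OF this T'(1)] have "colorable F k"
      using T'(2) mi_pos by (auto simp: colorable_def Un_absorb2)
    with ncol show False ..
  qed
  with T'(4) that show ?thesis by blast
qed

text \<open>Lovasz's replication argument. Color \<open>F - {y}\<close> and delete the class of
  \<open>x\<close> except \<open>x\<close> itself. A \<open>k\<close>-clique in the rest uses every
  color, hence contains \<open>x\<close>, and could be enlarged by the twin \<open>y\<close>. So the
  rest needs only \<open>k - 1\<close> colors, and the deleted vertices together with
  \<open>y\<close> form a stable set.\<close>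

lemma mi_no_twins:
  assumes "x \<in> F" "y \<in> F" "x \<noteq> y" "x \<sim> y"
    and twins: "\<And>w. w \<in> F - {x, y} \<Longrightarrow> w \<sim> x \<longleftrightarrow> w \<sim> y"
  shows False
proof -
  obtain c where c: "coloring (F - {y}) k c"
    using mi_colorable_proper[of "F - {y}"] assms by (auto simp: colorable_def)
  define T where "T = {v \<in> F - {y}. c v = c x} - {x}"
  let ?U = "F - {y} - T"
  have x: "x \<in> F - {y}" using assms by simp
  have "colorable ?U (k - 1)"
  proof (rule mi_colorable)
    show "?U \<subset> F" using assms by blast
    fix K assume K: "K \<subseteq> ?U" "clq K"
    have "card K \<noteq> k"
    proof
      assume cK: "card K = k"
      have inj: "inj_on c K" using coloring_inj_on_clq[OF c] K by blast
      have "c ` K \<subseteq> {..<k}" using c K unfolding coloring_def by blast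
      moreover have "card (c ` K) = k" using inj cK card_image by blast
      ultimately have "c ` K = {..<k}" by (simp add: card_subset_eq)
      moreover have "c x < k" using c x by (auto simp: coloring_def)
      ultimately have "c x \<in> c ` K" by simp
      then obtain v where v: "v \<in> K" "c v = c x" by auto
      then have xK: "x \<in> K" using K by (auto simp: T_def)
      have "clq (insert y K)"
        unfolding clq_def
      proof (intro ballI impI)
        have *: "w \<sim> y" if "w \<in> K" for w
        proof (cases "w = x")
          case False
          then show ?thesis using that K xK twins[of w] by (auto simp: clq_def)
        qed (use assms in simp)
        fix u w assume "u \<in> insert y K" "w \<in> insert y K" "u \<noteq> w"
        then show "u \<sim> w" using *[of u] *[of w] K(2) sym[of w y] by (auto simp: clq_def)
      qed
      then have "card (insert y K) \<le> k" using K assms by (intro bound) auto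
      moreover have "y \<notin> K" "finite K" using K finite_subset[OF _ mi_finite] by auto
      ultimately show False using cK by simp
    qed
    moreover have "card K \<le> k" using bound[of K] K by blast
    ultimately show "card K \<le> k - 1" by simp
  qed
  then obtain d where d: "coloring ?U (k - 1) d" by (auto simp: colorable_def)
  have "stable (insert y T)"
  proof -
    have "\<not> u \<sim> v" if "u \<in> T" "v \<in> T" for u v
    proof -
      have "u \<in> F - {y}" "v \<in> F - {y}" "c u = c v" using that by (auto simp: T_def)
      then show ?thesis using c unfolding coloring_def by blast
    qed
    moreover have "\<not> u \<sim> y" if "u \<in> T" for u
    proof -
      have "u \<in> F - {y}" "c u = c x" using that by (auto simp: T_def)
      then have "\<not> u \<sim> x" using c x unfolding coloring_def by blast
      then show ?thesis using twins[of u] that by (auto simp: T_def)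
    qed
    ultimately show ?thesis using sym by (fastforce simp: stable_def irrefl)
  qed
  from coloring_add_class[OF d this] have "colorable (?U \<union> insert y T) k"
    using mi_pos by (auto simp: colorable_def)
  moreover have "?U \<union> insert y T = F" using assms by (auto simp: T_def)
  ultimately show False using ncol by simp
qed

text \<open>Two vertices of a homogeneous clique are adjacent twins. Otherwise let \<open>K\<close>
  be a maximum clique of \<open>X\<close>: color \<open>F\<close> with \<open>X\<close> shrunk to
  \<open>K\<close>, color \<open>X\<close> separately with \<open>card K\<close> colors, and rename
  the latter to the colors found on \<open>K\<close>. A vertex outside \<open>X\<close> with a
  neighbor in \<open>X\<close> is adjacent to all of \<open>K\<close>, so it avoids these
  colors.\<close>

lemma mi_homogeneous:
  assumes X: "homogeneous X F" "2 \<le> card X"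
  shows "X = F"
proof (rule ccontr)
  assume "X \<noteq> F"
  then have XF: "X \<subset> F" using X by (auto simp: homogeneous_def)
  have fX: "finite X" using XF mi_finite finite_subset by blast
  show False
  proof (cases "clq X")
    case True
    obtain x y where xy: "x \<in> X" "y \<in> X" "x \<noteq> y" using X(2) fX
      by (metis card_le_Suc0_iff_eq not_less_eq_eq numeral_2_eq_2)
    show False
    proof (rule mi_no_twins[of x y])
      fix w assume "w \<in> F - {x, y}"
      then show "w \<sim> x \<longleftrightarrow> w \<sim> y" using xy X(1) True
        by (cases "w \<in> X") (auto simp: homogeneous_def clq_def)
    qed (use xy True XF in \<open>auto simp: clq_def\<close>)
  next
    case False
    let ?Q = "\<lambda>K. K \<subseteq> X \<and> clq K"
    have "\<forall>L. ?Q L \<longrightarrow> card L < Suc (card X)"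
      using fX by (simp add: card_mono less_Suc_eq_le)
    moreover have "?Q {}" by (simp add: clq_def)
    ultimately obtain K where K: "?Q K" and Kmax: "\<And>L. ?Q L \<Longrightarrow> card L \<le> card K"
      using ex_has_greatest_nat[of ?Q "{}" card "Suc (card X)"] by metis
    \<comment> \<open>As \<open>X\<close> is not a clique, shrinking it to \<open>K\<close> really
      removes a vertex, so minimality of \<open>F\<close> applies.\<close>
    have "K \<subset> X" using K False by auto
    then have "(F - X) \<union> K \<subset> F" using XF by blast
    then obtain c where c: "coloring ((F - X) \<union> K) k c"
      using mi_colorable_proper unfolding colorable_def by blast
    obtain d where d: "coloring X (card K) d"
      using mi_colorable[OF XF, of "card K"] Kmax unfolding colorable_def by blast
    have fK: "finite K" using K fX finite_subset by blast
    have "inj_on c K" using c K by (intro coloring_inj_on_clq) auto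
    then have "card (c ` K) = card K" by (rule card_image)
    then obtain g where g: "bij_betw g {..<card K} (c ` K)"
      using fK by (metis bij_betw_from_nat_into_finite finite_imageI)
    define c' where "c' v = (if v \<in> X then g (d v) else c v)" for v
    have gK: "g (d v) \<in> c ` K" if "v \<in> X" for v
      using d g that by (auto simp: coloring_def bij_betw_def)
    have cross: "c v \<noteq> g (d u)" if uv: "u \<in> X" "v \<in> F - X" "u \<sim> v" for u v
    proof
      assume "c v = g (d u)"
      then obtain w where w: "w \<in> K" "c v = c w" using gK[of u] uv(1) by auto
      have "w \<in> X" using w K by blast
      then have "v \<sim> w" using that X(1) sym unfolding homogeneous_def by blast
      moreover have "v \<in> (F - X) \<union> K" "w \<in> (F - X) \<union> K" using that w by auto
      ultimately show False using c w(2) unfolding coloring_def by blast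
    qed
    have "coloring F k c'"
      unfolding coloring_def
    proof (intro conjI ballI impI)
      fix v assume "v \<in> F"
      then show "c' v < k" using gK[of v] c by (auto simp: c'_def coloring_def)
    next
      fix u v assume uv: "u \<in> F" "v \<in> F" "u \<sim> v"
      consider "u \<in> X" "v \<in> X" | "u \<in> X" "v \<notin> X" | "u \<notin> X" "v \<in> X" | "u \<notin> X" "v \<notin> X" by blast
      then show "c' u \<noteq> c' v"
      proof cases
        case 1
        then have "d u \<noteq> d v" "d u < card K" "d v < card K" using d uv by (auto simp: coloring_def)
        then have "g (d u) \<noteq> g (d v)" using g by (metis bij_betw_def inj_onD lessThan_iff)
        then show ?thesis using 1 by (simp add: c'_def)
      next
        case 2
        then show ?thesis using cross[of u v] uv by (auto simp: c'_def)
      next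
        case 3
        then show ?thesis using cross[of v u] uv sym by (auto simp: c'_def)
      next
        case 4
        then show ?thesis using c uv by (auto simp: c'_def coloring_def)
      qed
    qed
    with ncol show False by (auto simp: colorable_def)
  qed
qed

end

lemma min_imperfect_prime: "min_imperfect F \<Longrightarrow> prime_on F"
  unfolding prime_on_def by (metis min_imperfectE mi_homogeneous)

end

section \<open>Even pairs\<close>

text \<open>There are more vectors than coordinates. This is Gaussian elimination: coordinate
  \<open>v\<close> is cleared with a pivot vector \<open>a p\<close>, which leaves one vector and
  one coordinate less.\<close>

lemma linear_dependency:
  fixes a :: "'i \<Rightarrow> 'v \<Rightarrow> real"
  assumes "finite V" "finite I" "card V < card I"
  shows "\<exists>l. (\<exists>i\<in>I. l i \<noteq> 0) \<and> (\<forall>v\<in>V. (\<Sum>i\<in>I. l i * a i v) = 0)"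
  using assms
proof (induction V arbitrary: I a rule: finite_induct)
  case empty
  then have "I \<noteq> {}" by auto
  then show ?case by (intro exI[of _ "\<lambda>_. 1"]) auto
next
  case (insert v V)
  show ?case
  proof (cases "\<forall>i\<in>I. a i v = 0")
    case True
    have "card V < card I" using insert by simp
    then obtain l where "\<exists>i\<in>I. l i \<noteq> 0" "\<forall>u\<in>V. (\<Sum>i\<in>I. l i * a i u) = 0"
      using insert.IH[of I a] insert.prems by blast
    with True show ?thesis by (intro exI[of _ l]) auto
  next
    case False
    then obtain p where p: "p \<in> I" "a p v \<noteq> 0" by blast
    let ?J = "I - {p}"
    have "finite ?J" "card V < card ?J" using insert p by auto
    from insert.IH[OF this, of "\<lambda>i u. a i u - a i v / a p v * a p u"]
    obtain \<mu> where \<mu>: "\<exists>i\<in>?J. \<mu> i \<noteq> 0"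
      "\<forall>u\<in>V. (\<Sum>i\<in>?J. \<mu> i * (a i u - a i v / a p v * a p u)) = 0" by blast
    \<comment> \<open>The coefficient of the pivot collects the multiples of \<open>a p\<close> that
      were subtracted from the other vectors.\<close>
    define s where "s = - (\<Sum>i\<in>?J. \<mu> i * (a i v / a p v))"
    define l where "l i = (if i = p then s else \<mu> i)" for i
    have split: "(\<Sum>i\<in>I. l i * a i u) = s * a p u + (\<Sum>i\<in>?J. \<mu> i * a i u)" for u
    proof -
      have "(\<Sum>i\<in>I. l i * a i u) = l p * a p u + (\<Sum>i\<in>?J. l i * a i u)"
        using p insert.prems by (simp add: sum.remove)
      also have "(\<Sum>i\<in>?J. l i * a i u) = (\<Sum>i\<in>?J. \<mu> i * a i u)"
        by (intro sum.cong) (auto simp: l_def)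
      finally show ?thesis by (simp add: l_def)
    qed
    have "(\<Sum>i\<in>?J. \<mu> i * (a i u - a i v / a p v * a p u)) = s * a p u + (\<Sum>i\<in>?J. \<mu> i * a i u)" for u
      by (simp add: s_def right_diff_distrib sum_subtractf sum_distrib_right mult.assoc)
    with \<mu>(2) split have "\<forall>u\<in>V. (\<Sum>i\<in>I. l i * a i u) = 0" by simp
    moreover have "(\<Sum>i\<in>I. l i * a i v) = 0"
    proof -
      have "s * a p v = - (\<Sum>i\<in>?J. \<mu> i * a i v)"
        using p(2) by (simp add: s_def sum_distrib_right)
      then show ?thesis by (simp only: split)
    qed
    moreover have "\<exists>i\<in>I. l i \<noteq> 0" using \<mu>(1) by (auto simp: l_def)
    ultimately show ?thesis by blast
  qed
qed

text \<open>The matrix of intersection sizes is the all-ones matrix minus the identity. Summing the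
  relation over \<open>K j\<close> gives \<open>l j = T\<close> with \<open>T\<close> the sum of all
  coefficients; hence \<open>T = card I * T\<close>, which forces \<open>T = 0\<close> as soon as
  \<open>card I\<close> is at least 2.\<close>

lemma independent_of_transversals:
  fixes l :: "'i \<Rightarrow> real"
  assumes I: "finite I" "2 \<le> card I"
    and K: "\<And>j. j \<in> I \<Longrightarrow> finite (K j)"
    and meet: "\<And>i j. i \<in> I \<Longrightarrow> j \<in> I \<Longrightarrow> card (K j \<inter> a i) = (if i = j then 0 else 1)"
    and zero: "\<And>j v. j \<in> I \<Longrightarrow> v \<in> K j \<Longrightarrow> (\<Sum>i\<in>I. l i * of_bool (v \<in> a i)) = 0"
    and "i \<in> I"
  shows "l i = 0"
proof -
  define T where "T = (\<Sum>i\<in>I. l i)"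
  have *: "l j = T" if j: "j \<in> I" for j
  proof -
    have "0 = (\<Sum>v\<in>K j. \<Sum>i\<in>I. l i * of_bool (v \<in> a i))" using zero j by simp
    also have "\<dots> = (\<Sum>i\<in>I. \<Sum>v\<in>K j. l i * of_bool (v \<in> a i))" by (rule sum.swap)
    also have "\<dots> = (\<Sum>i\<in>I. l i * real (card (K j \<inter> a i)))"
      by (intro sum.cong refl) (simp add: K[OF j] sum_distrib_left[symmetric] Int_def)
    also have "\<dots> = (\<Sum>i\<in>I. if i = j then 0 else l i)"
      using meet j by (intro sum.cong refl) auto
    also have "\<dots> = T - l j"
    proof -
      have "(\<Sum>i\<in>I. if i = j then 0 else l i) = (\<Sum>i\<in>I - {j}. l i)"
        using I(1) j by (intro sum.mono_neutral_cong_right) auto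
      then show ?thesis using I(1) j by (simp add: T_def sum_diff1)
    qed
    finally show ?thesis by simp
  qed
  have "T = (\<Sum>i\<in>I. T)" using * by (subst T_def) (rule sum.cong, simp_all)
  then have "T = real (card I) * T" by simp
  then have "T = 0" using I(2) by auto
  with * \<open>i \<in> I\<close> show ?thesis by simp
qed

lemma card_fiber_1:
  assumes "inj_on c L" "i \<in> c ` L"
  shows "card {v \<in> L. c v = i} = 1"
proof -
  obtain v where "v \<in> L" "c v = i" using assms(2) by blast
  then have "{v \<in> L. c v = i} = {v}" using assms(1) by (auto simp: inj_on_def)
  then show ?thesis by simp
qed

lemma alternating_parity:
  fixes f :: "nat \<Rightarrow> bool"
  shows "(\<And>i. i < n \<Longrightarrow> f i \<noteq> f (Suc i)) \<Longrightarrow> even n \<longleftrightarrow> f 0 = f n"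
  by (induction n) (auto simp: less_Suc_eq)

section \<open>Reachability, induced paths and Kempe exchanges\<close>

context simple_graph begin

text \<open>Being a reflexive closure, this also relates a vertex outside \<open>X\<close> to
  itself; hence the membership assumptions in the facts below.\<close>

definition reach :: "'a set \<Rightarrow> 'a \<Rightarrow> 'a \<Rightarrow> bool" where
  "reach X = (\<lambda>u v. u \<in> X \<and> v \<in> X \<and> u \<sim> v)\<^sup>*\<^sup>*"

definition connected_on :: "'a set \<Rightarrow> bool" where
  "connected_on X \<longleftrightarrow> (\<forall>a\<in>X. \<forall>b\<in>X. reach X a b)"

definition component :: "'a set \<Rightarrow> 'a \<Rightarrow> 'a set" where
  "component X a = {b. reach X a b}"

lemma reach_refl [simp]: "reach X a a"
  by (simp add: reach_def)

lemma reach_edge: "u \<in> X \<Longrightarrow> v \<in> X \<Longrightarrow> u \<sim> v \<Longrightarrow> reach X u v"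
  by (auto simp: reach_def)

lemma reach_trans: "reach X a b \<Longrightarrow> reach X b c \<Longrightarrow> reach X a c"
  by (simp add: reach_def)

lemma reach_sym: "reach X a b \<Longrightarrow> reach X b a"
  unfolding reach_def by (rule sympD[OF symp_rtranclp]) (auto simp: symp_def sym)

lemma reach_mono: "reach X a b \<Longrightarrow> X \<subseteq> Y \<Longrightarrow> reach Y a b"
  unfolding reach_def by (erule rtranclp_mono[THEN predicate2D, rotated]) blast

lemma reach_in: "reach X a b \<Longrightarrow> a \<in> X \<Longrightarrow> b \<in> X"
  unfolding reach_def by (induction rule: rtranclp_induct) auto

lemma reach_crossing:
  assumes "reach X a b" "P a" "\<not> P b"
  obtains u v where "u \<in> X" "v \<in> X" "u \<sim> v" "P u" "\<not> P v"
proof -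
  from assms have "\<exists>u v. u \<in> X \<and> v \<in> X \<and> u \<sim> v \<and> P u \<and> \<not> P v"
    unfolding reach_def
  proof (induction rule: rtranclp_induct)
    case (step b c)
    then show ?case by (cases "P b") blast+
  qed simp
  with that show ?thesis by blast
qed

lemma component_self [simp]: "a \<in> component X a"
  by (simp add: component_def)

lemma component_subset: "a \<in> X \<Longrightarrow> component X a \<subseteq> X"
  using reach_in by (auto simp: component_def)

lemma component_closed: "b \<in> component X a \<Longrightarrow> a \<in> X \<Longrightarrow> c \<in> X \<Longrightarrow> b \<sim> c \<Longrightarrow> c \<in> component X a"
  using reach_trans[of X a b c] reach_edge[of b X c] reach_in[of X a b] by (simp add: component_def)

lemma connected_on_component:
  assumes "a \<in> X"
  shows "connected_on (component X a)"
proof -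
  have "reach (component X a) a b" if "reach X a b" for b
    using that unfolding reach_def
  proof (induction rule: rtranclp_induct)
    case (step b c)
    then have "b \<in> component X a" "c \<in> component X a"
      unfolding component_def reach_def by (auto intro: rtranclp.rtrancl_into_rtrancl)
    then show ?case using step
      by (intro rtranclp.rtrancl_into_rtrancl[OF step.IH]) auto
  qed simp
  then show ?thesis unfolding connected_on_def
    by (auto simp: component_def intro: reach_trans[OF reach_sym])
qed

definition walk :: "'a set \<Rightarrow> nat \<Rightarrow> (nat \<Rightarrow> 'a) \<Rightarrow> bool" where
  "walk X n p \<longleftrightarrow> (\<forall>i\<le>n. p i \<in> X) \<and> (\<forall>i<n. p i \<sim> p (Suc i))"

text \<open>The length \<open>n\<close> counts edges, so \<open>P_8\<close> is the case
  \<open>n = 7\<close>. Values of \<open>p\<close> beyond \<open>n\<close> are arbitrary.\<close>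

definition induced_path :: "'a set \<Rightarrow> nat \<Rightarrow> (nat \<Rightarrow> 'a) \<Rightarrow> bool" where
  "induced_path X n p \<longleftrightarrow> (\<forall>i\<le>n. p i \<in> X) \<and> inj_on p {..n} \<and>
     (\<forall>i\<le>n. \<forall>j\<le>n. p i \<sim> p j \<longleftrightarrow> j = Suc i \<or> i = Suc j)"

lemma reach_walk:
  assumes "reach X a b" "a \<in> X"
  obtains n p where "walk X n p" "p 0 = a" "p n = b"
proof -
  have "\<exists>n p. walk X n p \<and> p 0 = a \<and> p n = b"
    using assms unfolding reach_def
  proof (induction rule: rtranclp_induct)
    case base
    then show ?case by (intro exI[of _ 0] exI[of _ "\<lambda>_. a"]) (simp add: walk_def)
  next
    case (step b c)
    then obtain n p where "walk X n p" "p 0 = a" "p n = b" by blast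
    then show ?case using step.hyps
      by (intro exI[of _ "Suc n"] exI[of _ "p(Suc n := c)"]) (auto simp: walk_def less_Suc_eq le_Suc_eq)
  qed
  with that show ?thesis by blast
qed

lemma walk_shortcut:
  assumes "walk X n p" "i + 1 + d \<le> n" "p i \<sim> p (i + 1 + d)"
  shows "walk X (n - d) (\<lambda>t. if t \<le> i then p t else p (t + d))"
  unfolding walk_def
proof (intro conjI allI impI)
  fix t assume t: "t \<le> n - d"
  show "(if t \<le> i then p t else p (t + d)) \<in> X" using assms t by (auto simp: walk_def)
next
  fix t assume t: "t < n - d"
  consider "t < i" | "t = i" | "i < t" by linarith
  then show "(if t \<le> i then p t else p (t + d)) \<sim> (if Suc t \<le> i then p (Suc t) else p (Suc t + d))"
  proof cases
    case 3
    moreover have "t + d < n" using t by simp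
    ultimately show ?thesis using assms(1) by (auto simp: walk_def)
  qed (use assms t in \<open>auto simp: walk_def\<close>)
qed

text \<open>A shortest walk is an induced path, because a chord or a repeated vertex would shorten
  it.\<close>

lemma reach_induced_path:
  assumes "reach X a b" "a \<in> X"
  obtains n p where "induced_path X n p" "p 0 = a" "p n = b"
proof -
  let ?P = "\<lambda>n. \<exists>p. walk X n p \<and> p 0 = a \<and> p n = b"
  define n where "n = (LEAST n. ?P n)"
  have "\<exists>n. ?P n" using reach_walk[OF assms] by metis
  then have "?P n" unfolding n_def by (rule LeastI_ex)
  then obtain p where p: "walk X n p" "p 0 = a" "p n = b" by blast
  have least: "n \<le> m" if "walk X m q" "q 0 = a" "q m = b" for m q
    unfolding n_def by (rule Least_le) (use that in blast)
  have chord: "d = 0" if "i + 1 + d \<le> n" "p i \<sim> p (i + 1 + d)" for i d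
  proof -
    have "\<not> n - d \<le> i" "n - d + d = n" using that by auto
    then have "n \<le> n - d" using least[OF walk_shortcut[OF p(1) that]] p(2,3) by simp
    then show ?thesis using that by simp
  qed
  have neq: "p i \<noteq> p j" if "i < j" "j \<le> n" for i j
  proof
    assume eq: "p i = p j"
    show False
    proof (cases "j = n")
      case True
      have "walk X i p" using p(1) that by (auto simp: walk_def)
      from least[OF this] show False using p eq True that by simp
    next
      case False
      \<comment> \<open>With \<open>p i = p j\<close>, the edge leaving \<open>p j\<close> is a
        chord at \<open>p i\<close> that skips \<open>j - i\<close> vertices.\<close>
      then have "p j \<sim> p (Suc j)" using p that by (auto simp: walk_def)
      then show False using chord[of i "j - i"] eq that False by simp
    qed
  qed
  have fwd: "j = Suc i" if "i < j" "j \<le> n" "p i \<sim> p j" for i j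
    using chord[of i "j - i - 1"] that by simp
  have "induced_path X n p"
    unfolding induced_path_def
  proof (intro conjI allI impI)
    show "inj_on p {..n}" using neq by (intro linorder_inj_onI) auto
    show "p i \<in> X" if "i \<le> n" for i using p(1) that by (simp add: walk_def)
    show "p i \<sim> p j \<longleftrightarrow> j = Suc i \<or> i = Suc j" if "i \<le> n" "j \<le> n" for i j
    proof
      assume "p i \<sim> p j"
      then show "j = Suc i \<or> i = Suc j"
        using fwd[of i j] fwd[of j i] that sym[of "p i" "p j"] irrefl[of "p i"]
        by (cases i j rule: linorder_cases) auto
    next
      assume "j = Suc i \<or> i = Suc j"
      then show "p i \<sim> p j"
      proof
        assume "j = Suc i"
        then show ?thesis using p(1) that by (simp add: walk_def)
      next
        assume "i = Suc j"
        then have "p j \<sim> p i" using p(1) that by (simp add: walk_def)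
        then show ?thesis by (rule sym)
      qed
    qed
  qed
  with p that show ?thesis by blast
qed

lemma induced_path_adj:
  "induced_path X n p \<Longrightarrow> i \<le> n \<Longrightarrow> j \<le> n \<Longrightarrow> p i \<sim> p j \<longleftrightarrow> j = Suc i \<or> i = Suc j"
  by (simp add: induced_path_def)

lemma induced_path_in: "induced_path X n p \<Longrightarrow> i \<le> n \<Longrightarrow> p i \<in> X"
  by (simp add: induced_path_def)

lemma induced_path_mono: "induced_path X n p \<Longrightarrow> X \<subseteq> Y \<Longrightarrow> induced_path Y n p"
  by (auto simp: induced_path_def)

text \<open>The Kempe exchange of colors \<open>i\<close> and \<open>j\<close>, performed on every
  two-colored component that meets \<open>X\<close>. A whole set is allowed so that all neighbors of
  a vertex in one color class can be recolored at once.\<close>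

definition kempe :: "'a set \<Rightarrow> ('a \<Rightarrow> nat) \<Rightarrow> nat \<Rightarrow> nat \<Rightarrow> 'a set \<Rightarrow> 'a \<Rightarrow> nat" where
  "kempe W c i j X v =
     (if \<exists>a\<in>X. reach {u \<in> W. c u = i \<or> c u = j} a v then if c v = i then j else i else c v)"

text \<open>The exchanged set \<open>D\<close> is closed under adjacency within the two color
  classes, so an edge leaving \<open>D\<close> ends in a third color.\<close>

lemma coloring_kempe:
  assumes c: "coloring W k c" and ij: "i < k" "j < k" 
    and X: "X \<subseteq> {u \<in> W. c u = i \<or> c u = j}"
  shows "coloring W k (kempe W c i j X)"
proof -
  let ?W = "{u \<in> W. c u = i \<or> c u = j}"
  define D where "D = {v. \<exists>a\<in>X. reach ?W a v}"
  have DW: "D \<subseteq> ?W" using reach_in[of ?W] X unfolding D_def by blast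
  have closed: "v \<in> D" if uv: "u \<in> D" "v \<in> ?W" "u \<sim> v" for u v
  proof -
    obtain a where "a \<in> X" "reach ?W a u" using uv(1) by (auto simp: D_def)
    moreover have "reach ?W u v" using uv DW by (intro reach_edge) auto
    ultimately show ?thesis unfolding D_def using reach_trans by blast
  qed
  have eq: "kempe W c i j X v = (if v \<in> D then if c v = i then j else i else c v)" for v
    by (simp add: kempe_def D_def)
  have cross: "kempe W c i j X u \<noteq> kempe W c i j X v"
    if "u \<in> D" "v \<in> W" "u \<sim> v" for u v
  proof (cases "v \<in> D")
    case True
    then have "u \<in> W" "v \<in> W" "c u = i \<or> c u = j" "c v = i \<or> c v = j" using that DW by auto
    moreover have "c u \<noteq> c v" using calculation that c unfolding coloring_def by blast
    ultimately show ?thesis using True that by (auto simp: eq)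
  next
    case False
    then have "c v \<noteq> i \<and> c v \<noteq> j" using closed that by blast
    then show ?thesis using that False by (auto simp: eq)
  qed
  show ?thesis
    unfolding coloring_def
  proof (intro conjI ballI impI)
    show "kempe W c i j X v < k" if "v \<in> W" for v
      using that c ij by (simp add: eq coloring_def)
    show "kempe W c i j X u \<noteq> kempe W c i j X v" if "u \<in> W" "v \<in> W" "u \<sim> v" for u v
    proof (cases "u \<in> D \<or> v \<in> D")
      case True
      then show ?thesis using cross[of u v] cross[of v u] that sym by metis
    next
      case False
      then show ?thesis using that c by (simp add: eq coloring_def)
    qed
  qed
qed

lemma induced_path_two_colors:
  assumes c: "coloring W k c" and p: "induced_path {u \<in> W. c u = i \<or> c u = j} n p"
  shows "even n \<longleftrightarrow> c (p 0) = c (p n)"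
proof -
  have *: "c (p t) \<noteq> c (p (Suc t))" if "t < n" for t
    using that c induced_path_adj[OF p, of t "Suc t"] induced_path_in[OF p, of t]
      induced_path_in[OF p, of "Suc t"] by (auto simp: coloring_def)
  have in2: "c (p t) = i \<or> c (p t) = j" if "t \<le> n" for t
    using induced_path_in[OF p that] by blast
  have "even n \<longleftrightarrow> (c (p 0) = i) = (c (p n) = i)"
  proof (rule alternating_parity)
    fix t assume "t < n"
    then show "(c (p t) = i) \<noteq> (c (p (Suc t)) = i)"
      using *[of t] in2[of t] in2[of "Suc t"] by auto
  qed
  then show ?thesis using in2[of 0] in2[of n] by auto
qed

text \<open>For distinct vertices of \<open>F\<close> this is the notion of an even pair. It
  includes nonadjacency, since an edge is an induced path of length 1.\<close>

definition odd_path_free :: "'a set \<Rightarrow> 'a \<Rightarrow> 'a \<Rightarrow> bool" where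
  "odd_path_free F x y \<longleftrightarrow> (\<forall>n p. induced_path F n p \<and> p 0 = x \<and> p n = y \<longrightarrow> even n)"

lemma odd_path_free_not_adj:
  assumes "odd_path_free F x y" "x \<in> F" "y \<in> F"
  shows "\<not> x \<sim> y"
proof
  assume xy: "x \<sim> y"
  then have "x \<noteq> y" using irrefl by blast
  then have "induced_path F 1 (\<lambda>i. if i = 0 then x else y)"
    using assms xy sym[OF xy] irrefl unfolding induced_path_def
    by (auto simp: le_Suc_eq inj_on_def)
  then show False using assms unfolding odd_path_free_def by fastforce
qed

text \<open>Exchange the two colors on the Kempe component of \<open>x\<close>. It cannot contain
  \<open>y\<close>: an induced path joining them in two alternating colors would have odd
  length.\<close>

lemma coloring_same_color:
  assumes c: "coloring W k c" and xy: "x \<in> W" "y \<in> W" and free: "odd_path_free W x y"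
  obtains d where "coloring W k d" "d x = d y"
proof (cases "c x = c y")
  case False
  let ?W = "{u \<in> W. c u = c x \<or> c u = c y}"
  let ?d = "kempe W c (c x) (c y) {x}"
  have d: "coloring W k ?d"
    using c xy by (intro coloring_kempe) (auto simp: coloring_def)
  have "\<not> reach ?W x y"
  proof
    assume r: "reach ?W x y"
    have "x \<in> ?W" using xy by simp
    from reach_induced_path[OF r this]
    obtain n p where p: "induced_path ?W n p" "p 0 = x" "p n = y" .
    then have "odd n" using induced_path_two_colors[OF c p(1)] False by simp
    moreover have "induced_path W n p" using p(1) by (rule induced_path_mono) blast
    ultimately show False using free p unfolding odd_path_free_def by blast
  qed
  then have "?d x = ?d y" using False by (simp add: kempe_def)
  with d that show ?thesis by blast
qed (use c that in blast)

section \<open>Gasparian's rank argument and even pairs\<close>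

context
  fixes F k
  assumes mi: "min_imperfect F"
    and bound: "\<And>K. K \<subseteq> F \<Longrightarrow> clq K \<Longrightarrow> card K \<le> k"
    and ncol: "\<not> colorable F k"
begin

lemmas mi_facts = mi bound ncol

text \<open>
  The stable set \<open>S\<close> and the color classes of the graphs \<open>F - w\<close> for \<open>w \<in> S\<close> form a family in which
  every member is avoided by a maximum clique, which then meets all the other members exactly once.
  Hence their incidence vectors are linearly independent (Gasparian's argument).
\<close>

lemma mi_independent_family:
  assumes S: "stable S" "S \<subseteq> F" "S \<noteq> {}"
    and col: "\<And>w. w \<in> S \<Longrightarrow> coloring (F - {w}) k (col w)"
    and V: "V \<subseteq> F"
    and sep: "\<And>u. u \<in> F - V \<Longrightarrow> \<exists>v\<in>V. (u \<in> S \<longleftrightarrow> v \<in> S) \<and> (\<forall>w\<in>S. w \<noteq> u \<and> w \<noteq> v \<and> col w u = col w v)"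
  shows "Suc (card S * k) \<le> card V"
proof -
  \<comment> \<open>\<open>None\<close> stands for \<open>S\<close>, and \<open>Some (w, t)\<close>
    for color class \<open>t\<close> of \<open>F - {w}\<close>. The number of indices is the bound
    to be proved.\<close>
  define I where "I = insert None (Some ` (S \<times> {..<k}))"
  define a where "a i = (case i of None \<Rightarrow> S | Some (w, t) \<Rightarrow> {v \<in> F - {w}. col w v = t})" for i
  have finF: "finite F" by (rule mi_finite[OF mi_facts])
  have finS: "finite S" using S finF finite_subset by blast
  have finI: "finite I" using finS by (simp add: I_def)
  have "card I = Suc (card (Some ` (S \<times> {..<k})))" using finS by (simp add: I_def)
  also have "card (Some ` (S \<times> {..<k})) = card S * k" by (simp add: card_image card_cartesian_product)
  finally have cardI: "card I = Suc (card S * k)" .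
  have kpos: "0 < k" by (rule mi_pos[OF mi_facts])
  have stab: "stable (a i) \<and> a i \<subseteq> F" if "i \<in> I" for i
  proof (cases i)
    case None
    then show ?thesis using S by (simp add: a_def)
  next
    case (Some wt)
    then obtain w t where i: "i = Some (w, t)" "w \<in> S" using \<open>i \<in> I\<close> by (auto simp: I_def)
    then show ?thesis using col[OF i(2)] unfolding a_def coloring_def stable_def by fastforce
  qed
  have I_Some: "\<exists>w t. i = Some (w, t) \<and> w \<in> S \<and> t < k" if "i \<in> I" "i \<noteq> None" for i
    using that by (auto simp: I_def)
  \<comment> \<open>A \<open>k\<close>-clique that avoids \<open>w\<close> is colored by
    \<open>col w\<close> with \<open>k\<close> distinct colors, so it meets each class exactly
    once.\<close>
  have full: "card (K \<inter> a (Some (w, t))) = 1"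
    if K: "K \<subseteq> F" "clq K" "card K = k" "w \<notin> K" and wt: "w \<in> S" "t < k" for K w t
  proof -
    have KF: "K \<subseteq> F - {w}" using K by blast
    have inj: "inj_on (col w) K" using coloring_inj_on_clq[OF col KF] K wt by blast
    have "col w ` K \<subseteq> {..<k}" using col[OF wt(1)] KF unfolding coloring_def by blast
    moreover have "card (col w ` K) = k" using inj K card_image by blast
    ultimately have "col w ` K = {..<k}" by (simp add: card_subset_eq)
    then have "card {v \<in> K. col w v = t} = 1" using wt by (intro card_fiber_1[OF inj]) simp
    moreover have "K \<inter> a (Some (w, t)) = {v \<in> K. col w v = t}" using KF by (auto simp: a_def)
    ultimately show ?thesis by simp
  qed
  \<comment> \<open>If \<open>K\<close> misses \<open>S\<close>, it meets all the color classes, so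
    the avoided member is \<open>S\<close>. Otherwise \<open>K\<close> meets \<open>S\<close> in a
    single \<open>u\<close>, and the avoided member is a class \<open>t\<close> of
    \<open>F - {u}\<close>; the \<open>k - 1\<close> vertices of \<open>K - {u}\<close> then use
    each color other than \<open>t\<close> exactly once.\<close>
  have meet: "card (K \<inter> a i) = 1"
    if K: "K \<subseteq> F" "clq K" "card K = k" and j: "j \<in> I" "K \<inter> a j = {}" and i: "i \<in> I" "i \<noteq> j" for K i j
  proof (cases "K \<inter> S = {}")
    case True
    have "j = None"
    proof (rule ccontr)
      assume "j \<noteq> None"
      then obtain w t where "j = Some (w, t)" "w \<in> S" "t < k" using I_Some j(1) by blast
      then show False using full[of K w t] True K j by auto
    qed
    then obtain w t where "i = Some (w, t)" "w \<in> S" "t < k" using I_Some i by blast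
    then show ?thesis using full[of K w t] True K by auto
  next
    case False
    then obtain u where u: "u \<in> K" "u \<in> S" by blast
    have KS: "K \<inter> S = {u}" using u S(1) K(2) unfolding stable_def clq_def by blast
    have "j \<noteq> None"
    proof
      assume "j = None"
      then show False using j(2) KS by (simp add: a_def)
    qed
    then obtain w t where wt: "j = Some (w, t)" "w \<in> S" "t < k" using I_Some j(1) by blast
    have "w \<in> K" using full[of K w t] K wt j(2) by auto
    then have "w = u" using wt KS by blast
    show ?thesis
    proof (cases i)
      case None
      then show ?thesis using KS by (simp add: a_def)
    next
      case (Some x)
      then obtain w' t' where wt': "i = Some (w', t')" "w' \<in> S" "t' < k" using I_Some i(1) by blast
      show ?thesis
      proof (cases "w' = u")
        case False
        then have "w' \<notin> K" using KS wt' by blast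
        then show ?thesis using full[of K w' t'] K wt' by simp
      next
        case True
        let ?L = "K - {u}"
        have tt': "t' \<noteq> t" using True wt' wt \<open>w = u\<close> i by auto
        have LF: "?L \<subseteq> F - {u}" using K by blast
        have inj: "inj_on (col u) ?L"
          using coloring_inj_on_clq[OF col LF] K u clq_mono[of K ?L] by blast
        have fK: "finite K" using K(1) finF finite_subset by blast
        have "col u ` ?L \<subseteq> {..<k} - {t}"
        proof -
          have "col u v \<noteq> t" if "v \<in> ?L" for v
          proof
            assume "col u v = t"
            then have "v \<in> K \<inter> a j" using that LF wt \<open>w = u\<close> by (auto simp: a_def)
            then show False using j(2) by blast
          qed
          moreover have "col u v < k" if "v \<in> ?L" for v
            using col[OF u(2)] LF that unfolding coloring_def by blast
          ultimately show ?thesis by blast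
        qed
        moreover have "card (col u ` ?L) = card ({..<k} - {t})"
          using card_image[OF inj] fK K(3) u wt by simp
        ultimately have "col u ` ?L = {..<k} - {t}" by (intro card_subset_eq) auto
        then have "card {v \<in> ?L. col u v = t'} = 1"
          using wt' tt' by (intro card_fiber_1[OF inj]) simp
        moreover have "K \<inter> a i = {v \<in> ?L. col u v = t'}" using LF wt' True by (auto simp: a_def)
        ultimately show ?thesis by simp
      qed
    qed
  qed
  have "\<forall>j\<in>I. \<exists>K. K \<subseteq> F \<and> clq K \<and> card K = k \<and> K \<inter> a j = {}"
  proof
    fix j assume "j \<in> I"
    then obtain K where "K \<subseteq> F - a j" "clq K" "card K = k"
      using mi_clique_avoiding[OF mi_facts, of "a j"] stab by blast
    then show "\<exists>K. K \<subseteq> F \<and> clq K \<and> card K = k \<and> K \<inter> a j = {}" by blast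
  qed
  then obtain K where K: "\<forall>j\<in>I. K j \<subseteq> F \<and> clq (K j) \<and> card (K j) = k \<and> K j \<inter> a j = {}" by metis
  show ?thesis
  proof (rule ccontr)
    assume "\<not> ?thesis"
    then have less: "card V < card I" using cardI by simp
    have finV: "finite V" using V finF finite_subset by blast
    obtain l where l: "\<exists>i\<in>I. l i \<noteq> 0" "\<forall>v\<in>V. (\<Sum>i\<in>I. l i * of_bool (v \<in> a i)) = (0::real)"
      using linear_dependency[OF finV finI less, of "\<lambda>i v. of_bool (v \<in> a i)"] by blast
    \<comment> \<open>A dependency on \<open>V\<close> is one on all of \<open>F\<close>: by
      \<open>sep\<close>, each vertex outside \<open>V\<close> lies in the same members of the
      family as some vertex of \<open>V\<close>.\<close>
    have zero: "(\<Sum>i\<in>I. l i * of_bool (u \<in> a i)) = 0" if "u \<in> F" for u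
    proof (cases "u \<in> V")
      case False
      then obtain v where v: "v \<in> V" "u \<in> S \<longleftrightarrow> v \<in> S"
        "\<forall>w\<in>S. w \<noteq> u \<and> w \<noteq> v \<and> col w u = col w v" using sep[of u] \<open>u \<in> F\<close> by blast
      have "u \<in> a i \<longleftrightarrow> v \<in> a i" if i: "i \<in> I" for i
      proof (cases i)
        case (Some x)
        then obtain w t where "i = Some (w, t)" "w \<in> S" using I_Some i by blast
        then show ?thesis using v V \<open>u \<in> F\<close> by (auto simp: a_def)
      qed (use v in \<open>simp add: a_def\<close>)
      then have "(\<Sum>i\<in>I. l i * of_bool (u \<in> a i)) = (\<Sum>i\<in>I. l i * of_bool (v \<in> a i))"
        by (intro sum.cong) auto
      then show ?thesis using l v by simp
    qed (use l in blast)
    have "l i = 0" if "i \<in> I" for i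
    proof (rule independent_of_transversals[where I = I and K = K and a = a])
      show "2 \<le> card I" using cardI S(3) finS kpos by (cases "card S * k") auto
      show "finite (K j)" if "j \<in> I" for j using K that finF finite_subset by blast
      show "card (K j \<inter> a i) = (if i = j then 0 else 1)" if "i \<in> I" "j \<in> I" for i j
        using meet[of "K j" j i] K that by auto
      show "(\<Sum>i\<in>I. l i * of_bool (v \<in> a i)) = 0" if "j \<in> I" "v \<in> K j" for j v
        using zero K that by blast
    qed (use finI that in auto)
    with l show False by blast
  qed
qed

lemma mi_two_le: "2 \<le> k"
proof (rule ccontr)
  assume "\<not> 2 \<le> k"
  then have k: "k = 1" using mi_pos[OF mi_facts] by simp
  have "\<not> u \<sim> v" if "u \<in> F" "v \<in> F" for u v
  proof
    assume uv: "u \<sim> v"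
    then have "clq {u, v}" using sym by (auto simp: clq_def)
    then have "card {u, v} \<le> 1" using bound[of "{u, v}"] that k by simp
    moreover have "u \<noteq> v" using uv irrefl by blast
    ultimately show False by simp
  qed
  then have "coloring F k (\<lambda>_. 0)" using k by (simp add: coloring_def)
  with ncol show False by (auto simp: colorable_def)
qed

text \<open>
  All the colorings of \<open>F - w\<close> can be chosen to agree on \<open>x\<close> and \<open>y\<close>, so the incidence vectors of such a
  family would be linearly independent already on \<open>F - {y}\<close>, which has too few vertices.
\<close>

lemma mi_no_even_pair:
  assumes xy: "x \<in> F" "y \<in> F" "x \<noteq> y" and free: "odd_path_free F x y"
  shows False
proof -
  have finF: "finite F" by (rule mi_finite[OF mi_facts])
  have "\<forall>S. S \<subseteq> F \<and> stable S \<longrightarrow> card S < Suc (card F)"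
    using finF by (simp add: card_mono less_Suc_eq_le)
  moreover have xy_stable: "stable {x, y}"
    using odd_path_free_not_adj[OF free xy(1,2)] sym[of y x] irrefl by (auto simp: stable_def)
  ultimately have "\<exists>S. (S \<subseteq> F \<and> stable S) \<and> (\<forall>T. T \<subseteq> F \<and> stable T \<longrightarrow> card T \<le> card S)"
    using ex_has_greatest_nat[of "\<lambda>S. S \<subseteq> F \<and> stable S" "{x, y}" card "Suc (card F)"] xy by simp
  then obtain S where S: "S \<subseteq> F" "stable S" and
    max: "\<And>T. T \<subseteq> F \<Longrightarrow> stable T \<Longrightarrow> card T \<le> card S" by blast
  define \<alpha> where "\<alpha> = card S"
  have \<alpha>2: "2 \<le> \<alpha>" using max[OF _ xy_stable] xy by (simp add: \<alpha>_def)
  \<comment> \<open>The rank argument with \<open>V = F\<close>, where the separation condition is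
    vacuous.\<close>
  have lower: "Suc (\<alpha> * k) \<le> card F"
  proof -
    have "\<exists>c. coloring (F - {w}) k c" if "w \<in> S" for w
      using mi_colorable_proper[OF mi_facts, of "F - {w}"] S that unfolding colorable_def by blast
    then obtain col where "\<And>w. w \<in> S \<Longrightarrow> coloring (F - {w}) k (col w)" by metis
    moreover have "S \<noteq> {}" using \<alpha>2 by (auto simp: \<alpha>_def)
    ultimately show ?thesis using mi_independent_family[of S col F] S by (simp add: \<alpha>_def)
  qed
  have same: "\<exists>c. coloring (F - {w}) k c \<and> c x = c y" if w: "w \<in> F - {x, y}" for w
  proof -
    have "F - {w} \<subset> F" using w by blast
    then obtain c where c: "coloring (F - {w}) k c"
      using mi_colorable_proper[OF mi_facts] unfolding colorable_def by blast
    have "odd_path_free (F - {w}) x y"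
      using free induced_path_mono[of "F - {w}" _ _ F] unfolding odd_path_free_def by blast
    then show ?thesis using coloring_same_color[OF c, of x y] xy w by auto
  qed
  have "2 * 2 \<le> \<alpha> * k" using \<alpha>2 mi_two_le by (intro mult_le_mono)
  then have "card {x, y} < card F" using lower xy by simp
  then obtain w where w: "w \<in> F - {x, y}"
    by (metis Diff_eq_empty_iff card_mono ex_in_conv finite.emptyI finite_insert not_less)
  then obtain c where c: "coloring (F - {w}) k c" "c x = c y" using same by blast
  define C where "C t = {v \<in> F - {w}. c v = t}" for t
  have Csub: "C t \<subseteq> F" "stable (C t)" for t
    using c unfolding C_def stable_def coloring_def by fastforce+
  have Cle: "card (C t) \<le> \<alpha>" for t using max Csub by (simp add: \<alpha>_def)
  have "F - {w} = (\<Union>t<k. C t)" using c by (auto simp: C_def coloring_def)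
  moreover have "card (\<Union>t<k. C t) = (\<Sum>t<k. card (C t))"
    using finF by (intro card_UN_disjoint) (auto simp: C_def)
  ultimately have "card (F - {w}) = (\<Sum>t<k. card (C t))" by simp
  then have total: "card F - 1 = (\<Sum>t<k. card (C t))" using w by (simp add: card_Diff_singleton)
  have "(\<Sum>t<k. card (C t)) \<le> (\<Sum>t<k. \<alpha>)" using Cle by (intro sum_mono)
  then have upper: "card F \<le> Suc (\<alpha> * k)" using total by (simp add: mult.commute)
  define t where "t = (if c x = 0 then 1 else (0::nat))"
  have t: "t < k" "t \<noteq> c x" using mi_two_le by (auto simp: t_def)
  have Ct: "card (C t) = \<alpha>"
  proof (rule ccontr)
    assume "card (C t) \<noteq> \<alpha>"
    then have "card (C t) < \<alpha>" using Cle[of t] by simp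
    then have "(\<Sum>t<k. card (C t)) < (\<Sum>t<k. \<alpha>)" using Cle t
      by (intro sum_strict_mono_ex1) auto
    then show False using total lower by (simp add: mult.commute)
  qed
  have nxy: "x \<notin> C t" "y \<notin> C t" using t c by (auto simp: C_def)
  have "\<exists>c. coloring (F - {w}) k c \<and> c x = c y" if "w \<in> C t" for w
    using same[of w] that nxy Csub by blast
  then obtain col where col: "\<And>w. w \<in> C t \<Longrightarrow> coloring (F - {w}) k (col w) \<and> col w x = col w y" by metis
  \<comment> \<open>Now \<open>y\<close> is a duplicate of the coordinate \<open>x\<close> for the
    whole family, so the rank argument works on \<open>F - {y}\<close>.\<close>
  have "Suc (card (C t) * k) \<le> card (F - {y})"
  proof (rule mi_independent_family[of "C t" col])
    show "C t \<noteq> {}" using Ct \<alpha>2 by auto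
    fix u assume "u \<in> F - (F - {y})"
    then show "\<exists>v\<in>F - {y}. (u \<in> C t \<longleftrightarrow> v \<in> C t) \<and> (\<forall>w\<in>C t. w \<noteq> u \<and> w \<noteq> v \<and> col w u = col w v)"
      using nxy xy col by (intro bexI[of _ x]) auto
  qed (use Csub col in auto)
  then show False using Ct upper xy finF by simp
qed

end

lemma min_imperfect_no_even_pair:
  assumes "min_imperfect F" "x \<in> F" "y \<in> F" "x \<noteq> y"
  shows "\<not> odd_path_free F x y"
  using assms by (metis min_imperfectE mi_no_even_pair)

section \<open>Attachments in prime bull-free graphs\<close>

definition nbrs :: "'a \<Rightarrow> 'a set" where
  "nbrs x = {u. x \<sim> u}"

text \<open>Triangle \<open>a\<close>, \<open>b\<close>, \<open>c\<close> with pendant vertices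
  \<open>d\<close> at \<open>a\<close> and \<open>e\<close> at \<open>b\<close>. The pattern of
  edges and nonedges forces the five vertices to be distinct.\<close>

definition bull_free :: "'a set \<Rightarrow> bool" where
  "bull_free V \<longleftrightarrow> \<not> (\<exists>a\<in>V. \<exists>b\<in>V. \<exists>c\<in>V. \<exists>d\<in>V. \<exists>e\<in>V.
     a \<sim> b \<and> b \<sim> c \<and> c \<sim> a \<and> a \<sim> d \<and> b \<sim> e \<and> \<not> a \<sim> e \<and> \<not> b \<sim> d \<and> \<not> c \<sim> d \<and> \<not> c \<sim> e \<and> \<not> d \<sim> e)"

definition C5_free :: "'a set \<Rightarrow> bool" where
  "C5_free V \<longleftrightarrow> \<not> (\<exists>a\<in>V. \<exists>b\<in>V. \<exists>c\<in>V. \<exists>d\<in>V. \<exists>e\<in>V.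
     a \<sim> b \<and> b \<sim> c \<and> c \<sim> d \<and> d \<sim> e \<and> e \<sim> a \<and> \<not> a \<sim> c \<and> \<not> b \<sim> d \<and> \<not> c \<sim> e \<and> \<not> d \<sim> a \<and> \<not> e \<sim> b)"

definition P8_free :: "'a set \<Rightarrow> bool" where
  "P8_free V \<longleftrightarrow> (\<nexists>p. induced_path V 7 p)"

lemma bull_freeD:
  assumes "bull_free V" "a \<in> V" "b \<in> V" "c \<in> V" "d \<in> V" "e \<in> V"
    "a \<sim> b" "b \<sim> c" "c \<sim> a" "a \<sim> d" "b \<sim> e"
    "\<not> a \<sim> e" "\<not> b \<sim> d" "\<not> c \<sim> d" "\<not> c \<sim> e" "\<not> d \<sim> e"
  shows False
  using assms unfolding bull_free_def by blast

lemma C5_freeD: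
  assumes "C5_free V" "a \<in> V" "b \<in> V" "c \<in> V" "d \<in> V" "e \<in> V"
    "a \<sim> b" "b \<sim> c" "c \<sim> d" "d \<sim> e" "e \<sim> a"
    "\<not> a \<sim> c" "\<not> b \<sim> d" "\<not> c \<sim> e" "\<not> d \<sim> a" "\<not> e \<sim> b"
  shows False
  using assms unfolding C5_free_def by blast

lemma bull_free_mono: "bull_free V \<Longrightarrow> U \<subseteq> V \<Longrightarrow> bull_free U"
  unfolding bull_free_def by blast

lemma C5_free_mono: "C5_free V \<Longrightarrow> U \<subseteq> V \<Longrightarrow> C5_free U"
  unfolding C5_free_def by blast

lemma P8_free_mono: "P8_free V \<Longrightarrow> U \<subseteq> V \<Longrightarrow> P8_free U"
  unfolding P8_free_def using induced_path_mono by blast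

lemma P8_free_short:
  assumes "P8_free V" "induced_path V n p"
  shows "n < 7"
proof (rule ccontr)
  assume "\<not> n < 7"
  then have "induced_path V 7 p"
    using assms(2) unfolding induced_path_def by (auto intro: inj_on_subset)
  with assms show False by (auto simp: P8_free_def)
qed

lemma mixed_edge:
  assumes "connected_on K" "a \<in> K" "b \<in> K" "h \<sim> a" "\<not> h \<sim> b"
  obtains f g where "f \<in> K" "g \<in> K" "f \<sim> g" "h \<sim> f" "\<not> h \<sim> g"
  using reach_crossing[of K a b "\<lambda>u. h \<sim> u"] assms unfolding connected_on_def by blast

lemma component_homogeneous: "a \<in> X \<Longrightarrow> homogeneous (component X a) X"
  unfolding homogeneous_def using component_subset[of a X] component_closed[of _ X a] sym
  by (metis Diff_iff)

lemma prime_on_connected: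
  assumes "finite F" "prime_on F" "a \<in> F" "b \<in> F" "a \<sim> b"
  shows "connected_on F"
proof -
  let ?K = "component F a"
  have "b \<in> ?K" using component_closed[of a F a b] assms by simp
  moreover have "finite ?K" using component_subset[of a F] assms finite_subset by blast
  moreover have "a \<noteq> b" using assms irrefl by blast
  ultimately have "card {a, b} \<le> card ?K" by (intro card_mono) auto
  then have "2 \<le> card ?K" using \<open>a \<noteq> b\<close> by simp
  then have "?K = F" using assms component_homogeneous unfolding prime_on_def by blast
  then show ?thesis using connected_on_component[of a F] assms by simp
qed

text \<open>A vertex \<open>h\<close> mixed on the component is mixed on one of its edges
  \<open>f g\<close>. It is not adjacent to \<open>x\<close>, or it would belong to the component;
  so the triangle \<open>x\<close>, \<open>f\<close>, \<open>g\<close> with \<open>z\<close>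
  attached at \<open>x\<close> and \<open>h\<close> at \<open>f\<close> is a bull.\<close>

lemma neighborhood_component_homogeneous:
  assumes bull: "bull_free V" and X: "X \<subseteq> V" and x: "x \<in> V" and z: "z \<in> V" "x \<sim> z"
    and anti: "\<And>u. u \<in> X \<Longrightarrow> \<not> z \<sim> u" and a: "a \<in> X \<inter> nbrs x"
  shows "homogeneous (component (X \<inter> nbrs x) a) X"
proof -
  let ?K = "component (X \<inter> nbrs x) a"
  have K: "?K \<subseteq> X \<inter> nbrs x" "connected_on ?K"
    using component_subset[OF a] connected_on_component[OF a] by auto
  have "(\<forall>u\<in>?K. h \<sim> u) \<or> (\<forall>u\<in>?K. \<not> h \<sim> u)" if h: "h \<in> X - ?K" for h
  proof (rule ccontr)
    assume "\<not> ?thesis"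
    then obtain f g where fg: "f \<in> ?K" "g \<in> ?K" "f \<sim> g" "h \<sim> f" "\<not> h \<sim> g"
      using mixed_edge[OF K(2)] by metis
    have "\<not> h \<sim> x"
    proof
      assume "h \<sim> x"
      then have "h \<in> X \<inter> nbrs x" using h sym by (auto simp: nbrs_def)
      then show False using component_closed[OF fg(1) a _ sym[OF fg(4)]] h by blast
    qed
    moreover have "x \<sim> f" "x \<sim> g" "f \<in> X" "g \<in> X" using fg K by (auto simp: nbrs_def)
    ultimately show False
      using bull_freeD[OF bull, of x f g z h] X x z fg h anti sym by blast
  qed
  then show ?thesis unfolding homogeneous_def using K by blast
qed

text \<open>
  A maximal connected set \<open>X \<supseteq> F\<close> that is anticomplete to the vertices anticomplete to \<open>F\<close>, and in
  which no proper homogeneous subset contains \<open>F\<close>, is homogeneous in \<open>V\<close>.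
\<close>

lemma prime_mixed_attachment:
  assumes fin: "finite V" and bull: "bull_free V" and prime: "prime_on V" and F: "F \<subseteq> V"
    and conn: "connected_on F" and two: "2 \<le> card F"
    and y: "y \<in> V - F" "\<And>u. u \<in> F \<Longrightarrow> \<not> y \<sim> u"
  obtains x z where "x \<in> V - F" "z \<in> V - F" "x \<sim> z" "\<And>u. u \<in> F \<Longrightarrow> \<not> z \<sim> u"
    "\<exists>u\<in>F. x \<sim> u" "\<exists>u\<in>F. \<not> x \<sim> u"
proof (rule ccontr)
  note obtain_thesis = that
  assume contra: "\<not> thesis"
  define A where "A = {z \<in> V - F. \<forall>u\<in>F. \<not> z \<sim> u}"
  have homF: "(\<forall>u\<in>F. x \<sim> u) \<or> (\<forall>u\<in>F. \<not> x \<sim> u)" if "x \<in> V - F" "z \<in> A" "x \<sim> z" for x z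
    using obtain_thesis[of x z] contra that unfolding A_def by blast
  define P where "P X \<longleftrightarrow> F \<subseteq> X \<and> X \<subseteq> V \<and> connected_on X \<and> (\<forall>z\<in>A. \<forall>u\<in>X. \<not> z \<sim> u) \<and>
    (\<forall>H. F \<subseteq> H \<and> homogeneous H X \<longrightarrow> H = X)" for X
  have "P F" using F conn by (auto simp: P_def A_def homogeneous_def)
  moreover have "\<forall>X. P X \<longrightarrow> card X < Suc (card V)"
    using fin by (simp add: P_def card_mono less_Suc_eq_le)
  ultimately have "\<exists>X. P X \<and> (\<forall>Y. P Y \<longrightarrow> card Y \<le> card X)"
    by (rule ex_has_greatest_nat)
  then obtain X where PX: "P X" and max: "\<And>Y. P Y \<Longrightarrow> card Y \<le> card X" by blast
  have X: "F \<subseteq> X" "X \<subseteq> V" "connected_on X" and XA: "\<And>z u. z \<in> A \<Longrightarrow> u \<in> X \<Longrightarrow> \<not> z \<sim> u"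
    and hull: "\<And>H. F \<subseteq> H \<Longrightarrow> homogeneous H X \<Longrightarrow> H = X"
    using PX unfolding P_def by blast+
  have finX: "finite X" using X(2) fin finite_subset by blast
  have yA: "y \<in> A" using y by (simp add: A_def)
  obtain f0 where f0: "f0 \<in> F" using two by (metis card.empty ex_in_conv not_numeral_le_zero)
  have "(\<forall>u\<in>X. w \<sim> u) \<or> (\<forall>u\<in>X. \<not> w \<sim> u)" if w: "w \<in> V - X" for w
  proof (rule ccontr)
    assume "\<not> ?thesis"
    then obtain u1 u2 where u: "u1 \<in> X" "w \<sim> u1" "u2 \<in> X" "\<not> w \<sim> u2" by blast
    have wF: "w \<in> V - F" using w X by blast
    \<comment> \<open>A neighbor \<open>z\<close> in \<open>A\<close> makes \<open>w\<close>
      complete to \<open>F\<close>. The component of \<open>X \<inter> nbrs w\<close> containing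
      \<open>F\<close> is then homogeneous in \<open>X\<close>, hence equal to \<open>X\<close>,
      although \<open>w\<close> has a nonneighbor there.\<close>
    have wA: "\<not> z \<sim> w" if z: "z \<in> A" for z
    proof
      assume "z \<sim> w"
      then have wz: "w \<sim> z" by (rule sym)
      have "w \<notin> A" using XA u by blast
      then have "\<forall>u\<in>F. w \<sim> u" using homF[OF wF z wz] wF by (auto simp: A_def)
      then have FN: "F \<subseteq> X \<inter> nbrs w" using X by (auto simp: nbrs_def)
      let ?K = "component (X \<inter> nbrs w) f0"
      have "F \<subseteq> ?K"
        using conn f0 FN reach_mono unfolding connected_on_def component_def by blast
      moreover have "homogeneous ?K X"
      proof (rule neighborhood_component_homogeneous[OF bull X(2) _ _ wz XA[OF z]])
        show "w \<in> V" "z \<in> V" using w z by (auto simp: A_def)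
        show "f0 \<in> X \<inter> nbrs w" using FN f0 by blast
      qed
      ultimately have "?K = X" using hull by blast
      moreover have "?K \<subseteq> X \<inter> nbrs w" using FN f0 by (intro component_subset) blast
      ultimately show False using u by (auto simp: nbrs_def)
    qed
    \<comment> \<open>A homogeneous set of the enlarged graph that contains \<open>F\<close>
      contains all of \<open>X\<close>, and then also \<open>w\<close>, which is mixed on
      \<open>X\<close>. So \<open>X\<close> could be enlarged.\<close>
    have "P (insert w X)"
      unfolding P_def
    proof (intro conjI allI impI)
      have rw: "reach (insert w X) u w" if "u \<in> insert w X" for u
      proof (cases "u = w")
        case False
        then have "reach X u u1" using X(3) u that unfolding connected_on_def by blast
        then have "reach (insert w X) u u1" by (rule reach_mono) blast
        moreover have "reach (insert w X) u1 w" using u sym[OF u(2)] by (intro reach_edge) auto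
        ultimately show ?thesis by (rule reach_trans)
      qed simp
      show "connected_on (insert w X)"
        unfolding connected_on_def using reach_trans[OF rw reach_sym[OF rw]] by blast
      show "\<forall>z\<in>A. \<forall>u\<in>insert w X. \<not> z \<sim> u" using XA wA by blast
      fix H assume H: "F \<subseteq> H \<and> homogeneous H (insert w X)"
      then have "homogeneous (H \<inter> X) X" unfolding homogeneous_def by blast
      moreover have "F \<subseteq> H \<inter> X" using H X(1) by blast
      ultimately have HX: "H \<inter> X = X" using hull[of "H \<inter> X"] by simp
      moreover have "w \<in> H"
      proof (rule ccontr)
        assume "w \<notin> H"
        then have "(\<forall>x\<in>H. w \<sim> x) \<or> (\<forall>x\<in>H. \<not> w \<sim> x)" using H unfolding homogeneous_def by blast
        then show False using u HX by blast
      qed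
      ultimately show "H = insert w X" using H unfolding homogeneous_def by blast
    qed (use X w in auto)
    then have "card (insert w X) \<le> card X" by (rule max)
    then show False using w finX by simp
  qed
  then have "homogeneous X V" using X unfolding homogeneous_def by blast
  moreover have "2 \<le> card X" using two card_mono[OF finX X(1)] by simp
  \<comment> \<open>This is absurd: \<open>V\<close> would be connected, while \<open>y\<close> has
    no neighbor in \<open>X\<close>.\<close>
  ultimately have "X = V" using prime unfolding prime_on_def by blast
  then have "reach X y f0" using X y f0 unfolding connected_on_def by blast
  then obtain u v where "u \<in> X" "v \<in> X" "u \<sim> v" "u = y"
    using reach_crossing[of X y f0 "\<lambda>u. u = y"] y f0 by blast
  then show False using XA yA by blast
qed

text \<open>An edge among the neighbors of \<open>x\<close> in \<open>F\<close> would span a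
  nontrivial component. That component is homogeneous in \<open>F\<close>, so it equals
  \<open>F\<close> by primality, contrary to the nonneighbor of \<open>x\<close>.\<close>

lemma attachment_stable:
  assumes bull: "bull_free V" and F: "F \<subseteq> V" "finite F" "prime_on F"
    and x: "x \<in> V" "z \<in> V" "x \<sim> z" and anti: "\<And>u. u \<in> F \<Longrightarrow> \<not> z \<sim> u"
    and mixed: "\<exists>u\<in>F. \<not> x \<sim> u"
  shows "stable (F \<inter> nbrs x)"
proof (rule ccontr)
  assume "\<not> ?thesis"
  then obtain f g where fg: "f \<in> F \<inter> nbrs x" "g \<in> F \<inter> nbrs x" "f \<sim> g" unfolding stable_def by blast
  let ?K = "component (F \<inter> nbrs x) f"
  have hom: "homogeneous ?K F"
    by (rule neighborhood_component_homogeneous[OF bull F(1) x anti fg(1)])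
  have KF: "?K \<subseteq> F \<inter> nbrs x" using fg(1) by (rule component_subset)
  then have "finite ?K" using F(2) finite_subset by blast
  moreover have "{f, g} \<subseteq> ?K" using component_closed[OF _ fg(1) fg(2,3)] by simp
  moreover have "f \<noteq> g" using fg irrefl by blast
  ultimately have "2 \<le> card ?K" using card_mono[of ?K "{f, g}"] by simp
  then have "?K = F" using hom F(3) unfolding prime_on_def by blast
  then show False using KF mixed by (auto simp: nbrs_def)
qed

text \<open>Color \<open>F - {s}\<close> and take a \<open>k\<close>-clique avoiding one color
  class. Without \<open>s\<close> it would have to use all \<open>k\<close> colors.\<close>

lemma min_imperfect_vertex_in_clique:
  assumes mi: "min_imperfect F" "\<And>K. K \<subseteq> F \<Longrightarrow> clq K \<Longrightarrow> card K \<le> k" "\<not> colorable F k"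
    and s: "s \<in> F"
  obtains K where "K \<subseteq> F" "clq K" "card K = k" "s \<in> K"
proof -
  have "F - {s} \<subset> F" using s by blast
  then obtain c where c: "coloring (F - {s}) k c"
    using mi_colorable_proper[OF mi] unfolding colorable_def by blast
  define T where "T = {v \<in> F - {s}. c v = 0}"
  have "stable T" using c unfolding T_def stable_def coloring_def by fastforce
  moreover have "T \<subseteq> F" by (auto simp: T_def)
  ultimately obtain K where K: "K \<subseteq> F - T" "clq K" "card K = k"
    using mi_clique_avoiding[OF mi] by blast
  have "s \<in> K"
  proof (rule ccontr)
    assume "s \<notin> K"
    then have KF: "K \<subseteq> F - {s}" using K by blast
    have "card (c ` K) = k" using coloring_inj_on_clq[OF c KF K(2)] K(3) card_image by blast
    moreover have "c ` K \<subseteq> {..<k}" using c KF unfolding coloring_def by blast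
    ultimately have "c ` K = {..<k}" by (simp add: card_subset_eq)
    then have "0 \<in> c ` K" using mi_pos[OF mi] by simp
    then show False using K KF by (auto simp: T_def)
  qed
  with K that show ?thesis by blast
qed

lemma prime_no_anticomplete_min_imperfect:
  assumes fin: "finite V" and bull: "bull_free V" and C5: "C5_free V" and P8: "P8_free V"
    and prime: "prime_on V" and F: "F \<subseteq> V"
    and mi: "min_imperfect F" "\<And>K. K \<subseteq> F \<Longrightarrow> clq K \<Longrightarrow> card K \<le> k" "\<not> colorable F k"
    and k: "3 \<le> k" and v: "v \<in> V - F" "\<And>u. u \<in> F \<Longrightarrow> \<not> v \<sim> u"
  shows False
proof -
  have finF: "finite F" by (rule mi_finite[OF mi])
  have primeF: "prime_on F" using mi(1) by (rule min_imperfect_prime)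
  have tri: "\<exists>f g. f \<in> F \<and> g \<in> F \<and> s \<sim> f \<and> s \<sim> g \<and> f \<sim> g" if s: "s \<in> F" for s
  proof -
    obtain K where K: "K \<subseteq> F" "clq K" "card K = k" "s \<in> K"
      using min_imperfect_vertex_in_clique[OF mi s] .
    have "finite K" using K finF finite_subset by blast
    then have "\<not> card (K - {s}) \<le> Suc 0" using K k by simp
    then obtain f g where fg: "f \<in> K - {s}" "g \<in> K - {s}" "f \<noteq> g"
      using \<open>finite K\<close> by (metis card_le_Suc0_iff_eq finite_Diff)
    have clqD: "a \<sim> b" if "a \<in> K" "b \<in> K" "a \<noteq> b" for a b
      using K(2) that unfolding clq_def by blast
    have "s \<sim> f" "s \<sim> g" "f \<sim> g" "f \<in> F" "g \<in> F" using fg K clqD by auto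
    then show ?thesis by blast
  qed
  obtain f0 where f0: "f0 \<in> F" using mi_nonempty[OF mi] by blast
  then obtain g0 where g0: "g0 \<in> F" "f0 \<sim> g0" using tri by blast
  have conn: "connected_on F" using prime_on_connected[OF finF primeF f0 g0] .
  have "f0 \<noteq> g0" using g0 irrefl by blast
  then have two: "2 \<le> card F" using card_mono[of F "{f0, g0}"] f0 g0 finF by simp
  obtain n z where n: "n \<in> V - F" and z: "z \<in> V - F" "n \<sim> z" "\<And>u. u \<in> F \<Longrightarrow> \<not> z \<sim> u"
    and mixed: "\<exists>u\<in>F. n \<sim> u" "\<exists>u\<in>F. \<not> n \<sim> u"
    using prime_mixed_attachment[OF fin bull prime F conn two v] by blast
  define S where "S = F \<inter> nbrs n"
  have S: "stable S" unfolding S_def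
    using attachment_stable[OF bull F finF primeF, of n z] n z mixed by blast
  obtain s where s: "s \<in> S" using mixed by (auto simp: S_def nbrs_def)
  have sF: "s \<in> F" "n \<sim> s" using s by (auto simp: S_def nbrs_def)
  have nS: "\<not> n \<sim> u" if "u \<in> F" "u \<notin> S" for u using that by (auto simp: S_def nbrs_def)
  have adjS: "u \<notin> S" if "u \<sim> t" "t \<in> S" for u t using S that unfolding stable_def by blast
  have nadj: "n \<sim> t" if "t \<in> S" for t using that by (auto simp: S_def nbrs_def)
  obtain f1 g1 where fg1: "f1 \<in> F" "g1 \<in> F" "s \<sim> f1" "s \<sim> g1" "f1 \<sim> g1" using tri sF by blast
  let ?N = "F \<inter> nbrs s"
  define Q where "Q = component ?N f1"
  have f1: "f1 \<in> ?N" using fg1 by (auto simp: nbrs_def)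
  have QN: "Q \<subseteq> ?N" unfolding Q_def using f1 by (rule component_subset)
  have connQ: "connected_on Q" unfolding Q_def using f1 by (rule connected_on_component)
  have Qclosed: "u \<in> Q" if "t \<in> Q" "t \<sim> u" "u \<in> F" "s \<sim> u" for t u
    using component_closed[OF _ f1] that unfolding Q_def nbrs_def by blast
  have QS: "u \<notin> S" "s \<sim> u" "u \<in> F" if "u \<in> Q" for u
    using that QN adjS[of u s] s sym by (auto simp: nbrs_def)
  have g1: "g1 \<in> Q" using Qclosed[of f1 g1] fg1 by (simp add: Q_def)
  have "finite Q" using QN finF finite_subset by blast
  moreover have "f1 \<noteq> g1" using fg1 irrefl by blast
  moreover have "{f1, g1} \<subseteq> Q" using g1 by (simp add: Q_def)
  ultimately have "2 \<le> card Q" using card_mono[of Q "{f1, g1}"] by simp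
  moreover have "Q \<noteq> F" using QS(2) sF irrefl by blast
  ultimately have "\<not> homogeneous Q F" using primeF unfolding prime_on_def by blast
  then obtain s' where s': "s' \<in> F - Q" "\<not> (\<forall>x\<in>Q. s' \<sim> x)" "\<not> (\<forall>x\<in>Q. \<not> s' \<sim> x)"
    unfolding homogeneous_def using QN by blast
  \<comment> \<open>Otherwise there is a bull: the triangle \<open>s\<close>, \<open>f\<close>,
    \<open>g\<close> with \<open>n\<close> attached at \<open>s\<close> and \<open>h\<close> at
    \<open>f\<close>.\<close>
  have homQ: "(\<forall>u\<in>Q. h \<sim> u) \<or> (\<forall>u\<in>Q. \<not> h \<sim> u)" if h: "h \<in> F - Q" "h \<notin> S" for h
  proof (rule ccontr)
    assume "\<not> ?thesis"
    then obtain f g where fg: "f \<in> Q" "g \<in> Q" "f \<sim> g" "h \<sim> f" "\<not> h \<sim> g"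
      using mixed_edge[OF connQ] by metis
    have "\<not> s \<sim> h" using Qclosed[OF fg(1) sym[OF fg(4)]] h by blast
    moreover have "\<not> n \<sim> f" "\<not> n \<sim> g" "\<not> n \<sim> h"
      using nS QS[OF fg(1)] QS[OF fg(2)] h by auto
    ultimately show False
      using bull_freeD[OF bull, of s f g n h] QS(2,3)[OF fg(1)] QS(2,3)[OF fg(2)] fg(3-) h sF n F
        sym[of s g] sym[of n s] sym[of h f] sym[of f n] sym[of g n] sym[of g h] by auto
  qed
  have s'S: "s' \<in> S" using homQ s' by blast
  obtain f g where fg: "f \<in> Q" "g \<in> Q" "f \<sim> g" "s' \<sim> f" "\<not> s' \<sim> g"
    using mixed_edge[OF connQ] s' by metis
  have ss': "\<not> s \<sim> s'" "\<not> s' \<sim> s" using S s s'S unfolding stable_def by blast+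
  \<comment> \<open>Otherwise there is a bull: the triangle \<open>s\<close>, \<open>f\<close>,
    \<open>g\<close> with \<open>z\<close> attached at \<open>s\<close> and \<open>s'\<close> at
    \<open>f\<close>.\<close>
  have other: "s' \<sim> z" if z: "z \<in> F" "s \<sim> z" "z \<notin> Q" for z
  proof (rule ccontr)
    assume "\<not> s' \<sim> z"
    moreover have "\<not> f \<sim> z" "\<not> g \<sim> z" using Qclosed fg z by blast+
    ultimately show False
      using bull_freeD[OF bull, of s f g z s'] QS(2,3)[OF fg(1)] QS(2,3)[OF fg(2)] fg(3-) z sF s'(1) F ss'
        sym[of s g] sym[of s' f] sym[of g s'] sym[of z s'] by auto
  qed
  \<comment> \<open>Both ends are neighbors of \<open>n\<close>. Length 3 closes through
    \<open>n\<close> to a \<open>C_5\<close>. In length 5 an inner vertex in \<open>S\<close> again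
    gives a \<open>C_5\<close> through \<open>n\<close>; without one, \<open>other\<close> puts
    \<open>p 1\<close> into \<open>Q\<close>, and as \<open>p 2\<close>, \<open>p 3\<close>,
    \<open>p 4\<close> are not mixed on \<open>Q\<close>, the vertex \<open>f\<close> can take the
    place of \<open>p 1\<close>. But \<open>f\<close> is adjacent to \<open>s' = p 5\<close>, which
    closes a \<open>C_5\<close>.\<close>
  have "odd_path_free F s s'"
    unfolding odd_path_free_def
  proof (intro allI impI)
    fix m p assume p: "induced_path F m p \<and> p 0 = s \<and> p m = s'"
    then have ip: "induced_path F m p" by blast
    have pF: "p i \<in> F" if "i \<le> m" for i using ip that by (rule induced_path_in)
    have pV: "p i \<in> V" if "i \<le> m" for i using pF[OF that] F by blast
    have adj: "p i \<sim> p j \<longleftrightarrow> j = Suc i \<or> i = Suc j" if "i \<le> m" "j \<le> m" for i j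
      using induced_path_adj[OF ip that] .
    have nV: "n \<in> V" using n by blast
    have "m < 7" using P8_free_short[OF P8 induced_path_mono[OF ip F]] .
    have pn: "n \<sim> p i \<longleftrightarrow> p i \<in> S" if "i \<le> m" for i using nS nadj pF[OF that] by blast
    have np: "p i \<sim> n \<longleftrightarrow> p i \<in> S" if "i \<le> m" for i using pn[OF that] sym by blast
    show "even m"
    proof (rule ccontr)
      assume "odd m"
      with \<open>m < 7\<close> have "m = 1 \<or> m = 3 \<or> m = 5" by presburger
      then consider "m = 1" | "m = 3" | "m = 5" by blast
      then show False
      proof cases
        case 1
        then show False using p adj[of 0 1] ss' by simp
      next
        case 2
        have "p 1 \<notin> S" "p 2 \<notin> S"
          using adjS[of "p 1" "p 0"] adjS[of "p 2" "p 3"] adj[of 1 0] adj[of 2 3] p s s'S 2 by auto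
        then show False
          using C5_freeD[OF C5, of n "p 0" "p 1" "p 2" "p 3"] p s s'S nV 2 pV adj pn np
          by (auto simp: eval_nat_numeral)
      next
        case 3
        note m5 = 3
        have 14: "p 1 \<notin> S" "p 4 \<notin> S"
          using adjS[of "p 1" "p 0"] adjS[of "p 4" "p 5"] adj[of 1 0] adj[of 4 5] p s s'S m5 by auto
        have 2: "p 2 \<notin> S"
        proof
          assume "p 2 \<in> S"
          moreover from this have "p 3 \<notin> S" using adjS[of "p 3" "p 2"] adj[of 3 2] m5 by auto
          ultimately show False
            using C5_freeD[OF C5, of n "p 2" "p 3" "p 4" "p 5"] p s s'S nV m5 pV adj pn np 14
            by (auto simp: eval_nat_numeral)
        qed
        have 3: "p 3 \<notin> S"
        proof
          assume "p 3 \<in> S"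
          then show False
            using C5_freeD[OF C5, of n "p 0" "p 1" "p 2" "p 3"] p s s'S nV m5 pV adj pn np 14 2
            by (auto simp: eval_nat_numeral)
        qed
        have p0: "s \<sim> p i \<longleftrightarrow> i = 1" if "i \<le> 5" for i
          using adj[of 0 i] that p m5 by auto
        have p1: "p 1 \<in> Q"
        proof (rule ccontr)
          assume "p 1 \<notin> Q"
          then have "p 5 \<sim> p 1" using other[of "p 1"] p0[of 1] pF[of 1] p m5 by simp
          then show False using adj[of 5 1] m5 by simp
        qed
        have hom: "(\<forall>u\<in>Q. p i \<sim> u) \<or> (\<forall>u\<in>Q. \<not> p i \<sim> u)" if "i \<in> {2, 3, 4}" for i
        proof -
          have "p i \<notin> Q" using p0[of i] QS(2)[of "p i"] that by auto
          then show ?thesis using homQ[of "p i"] pF[of i] 2 3 14 that m5 by auto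
        qed
        have "p 2 \<sim> f" using hom[of 2] p1 fg(1) adj[of 2 1] m5 by auto
        moreover have "\<not> p 3 \<sim> f" using hom[of 3] p1 fg(1) adj[of 3 1] m5 by auto
        moreover have "\<not> p 4 \<sim> f" using hom[of 4] p1 fg(1) adj[of 4 1] m5 by auto
        moreover have "f \<in> V" using QS(3)[OF fg(1)] F by blast
        moreover have "p 5 \<sim> f" using fg(4) p m5 by simp
        ultimately show False
          using C5_freeD[OF C5, of f "p 2" "p 3" "p 4" "p 5"] pV adj m5
            sym[of "p 2" f] sym[of f "p 3"] sym[of f "p 4"] by auto
      qed
    qed
  qed
  moreover have "s \<noteq> s'" using fg QS by blast
  ultimately show False using min_imperfect_no_even_pair[OF mi(1) sF(1)] s' by blast
qed

end

section \<open>Induced cycles of length seven\<close>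

lemma less_7_cases:
  assumes "(i::nat) < 7"
  shows "i = 0 \<or> i = 1 \<or> i = 2 \<or> i = 3 \<or> i = 4 \<or> i = 5 \<or> i = 6"
  using assms by linarith

text \<open>Here \<open>b i\<close> is to mean adjacency to the vertex \<open>i\<close> of a
  7-cycle; \<open>c1\<close> and \<open>c2\<close> come from bulls, \<open>c3\<close> from
  \<open>C_5\<close>. A run of at least two either has a start, and then has length three, or fills
  the cycle. Without runs no two true positions are at distance 3, so at most two remain, at
  distance 2. Patterns are given relative to their center \<open>k\<close>.\<close>

lemma cyclic_pattern_7:
  fixes b :: "nat \<Rightarrow> bool"
  assumes per: "\<And>i. b (i mod 7) = b i"
    and c1: "\<And>i. b i \<Longrightarrow> b (i + 1) \<Longrightarrow> \<not> b (i + 6) \<Longrightarrow> b (i + 2) \<and> \<not> b (i + 3) \<and> \<not> b (i + 4)"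
    and c2: "\<And>i. b i \<Longrightarrow> b (i + 1) \<Longrightarrow> \<not> b (i + 2) \<Longrightarrow> \<not> b (i + 4) \<and> \<not> b (i + 5)"
    and c3: "\<And>i. b i \<Longrightarrow> b (i + 3) \<Longrightarrow> b (i + 1) \<or> b (i + 2)"
  obtains "\<And>i. \<not> b i" | "\<And>i. b i"
  | k where "\<And>j. b (k + j) \<longleftrightarrow> j mod 7 = 0"
  | k where "\<And>j. b (k + j) \<longleftrightarrow> j mod 7 = 1 \<or> j mod 7 = 6"
  | k where "\<And>j. b (k + j) \<longleftrightarrow> j mod 7 = 0 \<or> j mod 7 = 1 \<or> j mod 7 = 6"
proof -
  note [simp del] = One_nat_def add_2_eq_Suc add_2_eq_Suc'
  have per7: "b (i + 7) = b i" for i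
    using per[of "i + 7"] per[of i] by simp
  have pattern: "b (k + j) \<longleftrightarrow> P (j mod 7)"
    if "b k = P 0" "b (k + 1) = P 1" "b (k + 2) = P 2" "b (k + 3) = P 3" "b (k + 4) = P 4"
      "b (k + 5) = P 5" "b (k + 6) = P 6" for k j and P :: "nat \<Rightarrow> bool"
  proof -
    have eq: "b (k + j) = b (k + j mod 7)"
      using per[of "k + j"] per[of "k + j mod 7"] by (simp add: mod_simps)
    have "j mod 7 < 7" by simp
    from less_7_cases[OF this] show ?thesis
      by (elim disjE) (simp_all only: eq that add_0_right)
  qed
  show thesis
  proof (cases "\<exists>i. b i \<and> b (i + 1)")
    case True
    then obtain i0 where i0: "b i0" "b (i0 + 1)" by blast
    show thesis
    proof (cases "\<exists>i. b i \<and> b (i + 1) \<and> \<not> b (i + 6)")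
      case True
      then obtain i where i: "b i" "b (i + 1)" "\<not> b (i + 6)" by blast
      have "b (i + 2) \<and> \<not> b (i + 3) \<and> \<not> b (i + 4)" using c1[OF i] .
      moreover from this have "\<not> b (i + 5)" using c2[of "i + 1"] i by (simp add: add.assoc)
      ultimately have n: "b (i + 2)" "\<not> b (i + 3)" "\<not> b (i + 4)" "\<not> b (i + 5)" by blast+
      have "b ((i + 1) + j) \<longleftrightarrow> j mod 7 = 0 \<or> j mod 7 = 1 \<or> j mod 7 = 6" for j
          by (rule pattern[where k = "i + 1" and P = "\<lambda>j. j = 0 \<or> j = 1 \<or> j = 6"])
            (use i n per7[of i] in \<open>simp_all add: add.assoc\<close>)
      then show thesis using that(5) by blast
    next
      case False
      \<comment> \<open>Adding 6 is going back by one modulo 7: as no run has a start, it extends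
        backwards forever.\<close>
      have step: "b (i0 + 6 * m) \<and> b (i0 + 6 * m + 1)" for m
      proof (induction m)
        case (Suc m)
        then have "b (i0 + 6 * m + 6)" using False by blast
        moreover have "b (i0 + 6 * m + 7)" using Suc per7 by blast
        ultimately show ?case by (simp add: algebra_simps)
      qed (use i0 in simp)
      have "b i" for i
      proof -
        \<comment> \<open>Going back \<open>i0 - i\<close> steps from \<open>i0\<close> leads to
          \<open>i\<close>; modulo 7 that number of steps is \<open>i0 + 6 * i\<close>.\<close>
        have "i0 + 6 * (i0 + 6 * i) = i + 7 * (i0 + 5 * i)" by simp
        then have "(i0 + 6 * (i0 + 6 * i)) mod 7 = i mod 7" by (simp only: mod_mult_self2)
        then show ?thesis using step[of "i0 + 6 * i"] per by metis
      qed
      then show thesis using that(2) by blast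
    qed
  next
    case False
    have far: "\<not> b (i + 3)" if "b i" for i
    proof
      assume "b (i + 3)"
      then have "b (i + 1) \<or> b (i + 2)" using c3 that by blast
      moreover have "\<not> b (i + 1)" using False that by blast
      moreover have "\<not> (b (i + 2) \<and> b (i + 2 + 1))" using False by blast
      ultimately show False using \<open>b (i + 3)\<close> by (simp add: add.assoc)
    qed
    show thesis
    proof (cases "\<exists>i. b i")
      case True
      then obtain i where i: "b i" by blast
      have n1: "\<not> b (i + 1)" using i False by blast
      have n6: "\<not> b (i + 6)" 
      proof
        assume "b (i + 6)"
        then have "\<not> b (i + 6 + 1)" using False by blast
        then show False using i per7[of i] by (simp add: add.assoc)
      qed
      have n3: "\<not> b (i + 3)" using far i by blast
      have n4: "\<not> b (i + 4)" using far[of "i + 4"] i per7[of i] by (auto simp: add.commute)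
      have n25: "\<not> (b (i + 2) \<and> b (i + 5))" using far[of "i + 2"] by (auto simp: add.commute)
      consider "\<not> b (i + 2)" "\<not> b (i + 5)" | "b (i + 2)" "\<not> b (i + 5)" | "\<not> b (i + 2)" "b (i + 5)"
        using n25 by blast
      then show thesis
      proof cases
        case 1
        have "b (i + j) \<longleftrightarrow> j mod 7 = 0" for j
          by (rule pattern[where k = "i" and P = "\<lambda>j. j = 0"])
            (use 1 i n1 n6 n3 n4 in \<open>simp_all\<close>)
        then show thesis using that(3) by blast
      next
        case 2
        have "b ((i + 1) + j) \<longleftrightarrow> j mod 7 = 1 \<or> j mod 7 = 6" for j
          by (rule pattern[where k = "i + 1" and P = "\<lambda>j. j = 1 \<or> j = 6"])
            (use 2 i n1 n6 n3 n4 per7[of i] in \<open>simp_all add: add.assoc\<close>)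
        then show thesis using that(4) by blast
      next
        case 3
        have "b ((i + 6) + j) \<longleftrightarrow> j mod 7 = 1 \<or> j mod 7 = 6" for j
          by (rule pattern[where k = "i + 6" and P = "\<lambda>j. j = 1 \<or> j = 6"])
            (use 3 i n1 n6 n3 n4 per7[of i] per7[of "i + 1"] per7[of "i + 2"] per7[of "i + 3"] per7[of "i + 4"]
            per7[of "i + 5"] in \<open>simp_all add: add.assoc\<close>)
        then show thesis using that(4) by blast
      qed
    next
      case False
      then show thesis using that(1) by blast
    qed
  qed
qed

lemma mod_7_add_left_cancel: "(k + i) mod 7 = (k + j) mod 7 \<longleftrightarrow> i mod 7 = j mod (7::nat)"
  by (induction k) (auto simp: mod_Suc split: if_splits)

section \<open>Attachments to an induced cycle of length 7\<close>

context simple_graph begin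

text \<open>The bound \<open>2 \<le> n\<close> keeps \<open>x\<close> off the path: the only path
  vertex adjacent to \<open>p 0\<close> is \<open>p 1\<close>, and it is adjacent to
  \<open>p 2\<close>, whereas \<open>x\<close> is not.\<close>

lemma induced_path_Cons:
  assumes p: "induced_path V n p" "2 \<le> n" and x: "x \<in> V" "x \<sim> p 0"
    and non: "\<And>i. 0 < i \<Longrightarrow> i \<le> n \<Longrightarrow> \<not> x \<sim> p i"
  shows "induced_path V (Suc n) (case_nat x p)"
proof -
  have adj: "x \<sim> p i \<longleftrightarrow> i = 0" "p i \<sim> x \<longleftrightarrow> i = 0" if "i \<le> n" for i
    using x(2) non[OF _ that] sym[of "p i" x] sym[of x "p 0"] by (cases "i = 0"; auto)+
  have neq: "x \<noteq> p i" if "i \<le> n" for i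
  proof
    assume eq: "x = p i"
    then have "p i \<sim> p 0" using x(2) by simp
    then have "i = 1" using induced_path_adj[OF p(1) that, of 0] by simp
    then have "x \<sim> p 2" using induced_path_adj[OF p(1), of 1 2] p(2) eq by simp
    then show False using non p(2) by simp
  qed
  have inj: "inj_on p {..n}" using p(1) by (simp add: induced_path_def)
  show ?thesis
    unfolding induced_path_def
  proof (intro conjI allI impI)
    fix i assume "i \<le> Suc n"
    then show "case_nat x p i \<in> V" using induced_path_in[OF p(1)] x(1) by (cases i) auto
  next
    show "inj_on (case_nat x p) {..Suc n}"
    proof (rule inj_onI)
      fix i j assume "i \<in> {..Suc n}" "j \<in> {..Suc n}" "case_nat x p i = case_nat x p j"
      then show "i = j"
        using neq neq[symmetric] inj by (cases i; cases j) (auto dest: inj_onD)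
    qed
  next
    fix i j assume "i \<le> Suc n" "j \<le> Suc n"
    then show "case_nat x p i \<sim> case_nat x p j \<longleftrightarrow> j = Suc i \<or> i = Suc j"
      using adj induced_path_adj[OF p(1)] irrefl by (cases i; cases j) auto
  qed
qed

text \<open>An induced \<open>C_7\<close>, indexed by all natural numbers with period 7 so that
  shifted indices need no reduction. Distinct residues give distinct vertices, since their
  neighborhoods on the cycle differ.\<close>

definition hole7 :: "'a set \<Rightarrow> (nat \<Rightarrow> 'a) \<Rightarrow> bool" where
  "hole7 V c \<longleftrightarrow> (\<forall>i. c i \<in> V) \<and> (\<forall>i. c (i mod 7) = c i) \<and>
     (\<forall>i j. c i \<sim> c j \<longleftrightarrow> (i + 1) mod 7 = j mod 7 \<or> (j + 1) mod 7 = i mod 7)"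

lemma hole7_in: "hole7 V c \<Longrightarrow> c i \<in> V"
  by (simp add: hole7_def)

lemma hole7_mono: "hole7 U c \<Longrightarrow> U \<subseteq> V \<Longrightarrow> hole7 V c"
  by (auto simp: hole7_def)

lemma hole7_mod: "hole7 V c \<Longrightarrow> c (i mod 7) = c i"
  by (simp add: hole7_def)

lemma hole7_adj:
  assumes "hole7 V c"
  shows "c (k + i) \<sim> c (k + j) \<longleftrightarrow> (i + 1) mod 7 = j mod 7 \<or> (j + 1) mod 7 = i mod 7"
proof -
  have "c (k + i) \<sim> c (k + j) \<longleftrightarrow> (k + (i + 1)) mod 7 = (k + j) mod 7 \<or> (k + (j + 1)) mod 7 = (k + i) mod 7"
    using assms by (simp add: hole7_def add.assoc)
  then show ?thesis by (simp only: mod_7_add_left_cancel)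
qed

lemma hole7_path:
  assumes c: "hole7 V c" and "n \<le> 5"
  shows "induced_path V n (\<lambda>i. c (k + i))"
  unfolding induced_path_def
proof (intro conjI allI impI)
  show "inj_on (\<lambda>i. c (k + i)) {..n}"
  proof (rule linorder_inj_onI)
    fix i j assume "i < j" "i \<in> {..n}" "j \<in> {..n}"
    then have ij: "i < j" "j \<le> 5" using assms(2) by auto
    show "c (k + i) \<noteq> c (k + j)"
    proof
      assume "c (k + i) = c (k + j)"
      moreover have "c (k + i) \<sim> c (k + (i + 1))" "c (k + j) \<sim> c (k + (j + 1))"
        unfolding hole7_adj[OF c] by simp_all
      ultimately have "c (k + j) \<sim> c (k + (i + 1))" "c (k + i) \<sim> c (k + (j + 1))" by simp_all
      then show False using ij unfolding hole7_adj[OF c] by (cases "j = 5") auto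
    qed
  qed auto
next
  fix i j assume "i \<le> n" "j \<le> n"
  then have "i mod 7 = i" "j mod 7 = j" "(i + 1) mod 7 = i + 1" "(j + 1) mod 7 = j + 1" using assms(2) by auto
  then show "c (k + i) \<sim> c (k + j) \<longleftrightarrow> j = Suc i \<or> i = Suc j"
    unfolding hole7_adj[OF c] by auto
qed (use hole7_in[OF c] in auto)

text \<open>\<open>M\<close> lists offsets from a center \<open>k\<close>, reduced modulo 7; offset
  6 is the predecessor of the center.\<close>

definition cyc :: "(nat \<Rightarrow> 'a) \<Rightarrow> 'a \<Rightarrow> nat \<Rightarrow> nat set \<Rightarrow> bool" where
  "cyc c x k M \<longleftrightarrow> (\<forall>j. x \<sim> c (k + j) \<longleftrightarrow> j mod 7 \<in> M)"

lemma cycD: "cyc c x k M \<Longrightarrow> x \<sim> c (k + j) \<longleftrightarrow> j mod 7 \<in> M"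
  by (simp add: cyc_def)

lemma hole7_attachment:
  assumes c: "hole7 V c" and bull: "bull_free V" and C5: "C5_free V" and x: "x \<in> V"
  obtains "\<And>i. \<not> x \<sim> c i" | "\<And>i. x \<sim> c i"
    | k where "cyc c x k {0}" | k where "cyc c x k {1, 6}" | k where "cyc c x k {0, 1, 6}"
proof -
  note [simp del] = One_nat_def add_2_eq_Suc add_2_eq_Suc'
  note cV = hole7_in[OF c]
  have adj: "c (k + i) \<sim> c (k + j) \<longleftrightarrow> (i + 1) mod 7 = j mod 7 \<or> (j + 1) mod 7 = i mod 7" for k i j
    by (rule hole7_adj[OF c])
  have adj0: "c k \<sim> c (k + j) \<longleftrightarrow> 1 = j mod 7 \<or> (j + 1) mod 7 = 0"
     "c (k + j) \<sim> c k \<longleftrightarrow> 1 = j mod 7 \<or> (j + 1) mod 7 = 0" for k j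
    using adj[of k 0 j] adj[of k j 0] by auto
  have per: "x \<sim> c (i mod 7) \<longleftrightarrow> x \<sim> c i" for i
    by (simp add: hole7_mod[OF c])
  \<comment> \<open>Two placements of a bull on a triangle formed by \<open>x\<close> and an edge of
    the cycle: \<open>bullx\<close> has a pendant vertex at \<open>x\<close>, \<open>bully\<close>
    has both at the ends of the edge.\<close>
  have bullx: False
    if "b \<sim> c'" "x \<sim> b" "x \<sim> c'" "x \<sim> d" "b \<sim> e" "\<not> x \<sim> e" "\<not> b \<sim> d" "\<not> c' \<sim> d" "\<not> c' \<sim> e" "\<not> d \<sim> e"
      "b \<in> V" "c' \<in> V" "d \<in> V" "e \<in> V" for b c' d e
    using bull_freeD[OF bull, of x b c' d e] that x sym[of x c'] by blast
  have bully: False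
    if "b \<sim> c'" "x \<sim> b" "x \<sim> c'" "b \<sim> d" "c' \<sim> e" "\<not> x \<sim> d" "\<not> x \<sim> e" "\<not> b \<sim> e" "\<not> c' \<sim> d" "\<not> d \<sim> e"
      "b \<in> V" "c' \<in> V" "d \<in> V" "e \<in> V" for b c' d e
    using bull_freeD[OF bull, of b c' x d e] that x sym[of x c'] by blast
  show thesis
  proof (rule cyclic_pattern_7[of "\<lambda>i. x \<sim> c i"])
    fix i assume i: "x \<sim> c i" "x \<sim> c (i + 1)" "\<not> x \<sim> c (i + 6)"
    have "x \<sim> c (i + 2)"
    proof (rule ccontr)
      assume "\<not> x \<sim> c (i + 2)"
      then show False using bully[of "c i" "c (i + 1)" "c (i + 6)" "c (i + 2)"] i cV
        by (simp add: adj adj0)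
    qed
    moreover have "\<not> x \<sim> c (i + 3)" "\<not> x \<sim> c (i + 4)"
      using bullx[of "c i" "c (i + 1)" "c (i + 3)" "c (i + 6)"]
        bullx[of "c i" "c (i + 1)" "c (i + 4)" "c (i + 6)"] i cV
      by (auto simp add: adj adj0)
    ultimately show "x \<sim> c (i + 2) \<and> \<not> x \<sim> c (i + 3) \<and> \<not> x \<sim> c (i + 4)" by blast
  next
    fix i assume i: "x \<sim> c i" "x \<sim> c (i + 1)" "\<not> x \<sim> c (i + 2)"
    then show "\<not> x \<sim> c (i + 4) \<and> \<not> x \<sim> c (i + 5)"
      using bullx[of "c (i + 1)" "c i" "c (i + 4)" "c (i + 2)"]
        bullx[of "c (i + 1)" "c i" "c (i + 5)" "c (i + 2)"] cV
      by (auto simp add: adj adj0)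
  next
    fix i assume i: "x \<sim> c i" "x \<sim> c (i + 3)"
    show "x \<sim> c (i + 1) \<or> x \<sim> c (i + 2)"
    proof (rule ccontr)
      assume "\<not> ?thesis"
      then show False
        using C5_freeD[OF C5, of x "c i" "c (i + 1)" "c (i + 2)" "c (i + 3)"] i cV x
          sym[of x "c (i + 3)"] sym[of "c (i + 2)" x]
        by (auto simp: adj adj0)
    qed
  next
    fix k assume "\<And>j. x \<sim> c (k + j) \<longleftrightarrow> j mod 7 = 0"
    then have "cyc c x k {0}" by (simp add: cyc_def)
    then show thesis by (rule that(3))
  next
    fix k assume "\<And>j. x \<sim> c (k + j) \<longleftrightarrow> j mod 7 = 1 \<or> j mod 7 = 6"
    then have "cyc c x k {1, 6}" by (simp add: cyc_def)
    then show thesis by (rule that(4))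
  next
    fix k assume "\<And>j. x \<sim> c (k + j) \<longleftrightarrow> j mod 7 = 0 \<or> j mod 7 = 1 \<or> j mod 7 = 6"
    then have "cyc c x k {0, 1, 6}" by (simp add: cyc_def)
    then show thesis by (rule that(5))
  qed (use per that(1,2) in blast)+
qed

lemma hole7_neq:
  assumes c: "hole7 V c"
  shows "c (k + 2) \<noteq> c k"
proof
  assume "c (k + 2) = c k"
  moreover have "c (k + 2) \<sim> c (k + 3)" "\<not> c (k + 0) \<sim> c (k + 3)"
    unfolding hole7_adj[OF c] by simp_all
  ultimately show False by simp
qed

text \<open>
  In the complement, no vertex mixed on the cycle is adjacent to a vertex anticomplete to it, so
  \<open>prime_mixed_attachment\<close> applies.
\<close>

lemma hole7_no_complete:
  assumes fin: "finite V" and bull: "bull_free V" and C5: "C5_free V" and prime: "prime_on V"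
    and c: "hole7 V c" and z: "z \<in> V"
  shows "\<exists>i. \<not> z \<sim> c i"
proof (rule ccontr)
  assume "\<not> ?thesis"
  then have zc: "z \<sim> c i" for i by blast
  note [simp del] = One_nat_def add_2_eq_Suc add_2_eq_Suc'
  interpret co: simple_graph "\<lambda>u v. u \<noteq> v \<and> \<not> u \<sim> v"
    by unfold_locales (auto dest: sym)
  note cV = hole7_in[OF c]
  have adj: "c (k + i) \<sim> c (k + j) \<longleftrightarrow> (i + 1) mod 7 = j mod 7 \<or> (j + 1) mod 7 = i mod 7" for k i j
    by (rule hole7_adj[OF c])
  have adj0: "c k \<sim> c (k + j) \<longleftrightarrow> 1 = j mod 7 \<or> (j + 1) mod 7 = 0"
     "c (k + j) \<sim> c k \<longleftrightarrow> 1 = j mod 7 \<or> (j + 1) mod 7 = 0" for k j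
    using adj[of k 0 j] adj[of k j 0] by auto
  \<comment> \<open>The bull is self-complementary: a bull of the complement is one of the graph
    with triangle \<open>d\<close>, \<open>e\<close>, \<open>c\<close> and pendant vertices
    \<open>b\<close> at \<open>d\<close> and \<open>a\<close> at \<open>e\<close>.\<close>
  have cobull: "co.bull_free V"
    unfolding co.bull_free_def
  proof (intro notI, elim bexE conjE)
    fix a b c d e
    assume V: "a \<in> V" "b \<in> V" "c \<in> V" "d \<in> V" "e \<in> V"
      and ne: "a \<noteq> b" "b \<noteq> c" "c \<noteq> a" "a \<noteq> d" "b \<noteq> e"
      and na: "\<not> a \<sim> b" "\<not> b \<sim> c" "\<not> c \<sim> a" "\<not> a \<sim> d" "\<not> b \<sim> e"
      and co: "\<not> (a \<noteq> e \<and> \<not> a \<sim> e)" "\<not> (b \<noteq> d \<and> \<not> b \<sim> d)" "\<not> (c \<noteq> d \<and> \<not> c \<sim> d)"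
        "\<not> (c \<noteq> e \<and> \<not> c \<sim> e)" "\<not> (d \<noteq> e \<and> \<not> d \<sim> e)"
    have "a \<noteq> e" "b \<noteq> d" "c \<noteq> d" "c \<noteq> e" using ne na co sym by blast+
    then have "a \<sim> e" "b \<sim> d" "c \<sim> d" "c \<sim> e" using co by blast+
    moreover have "d \<noteq> e" using calculation na sym by blast
    ultimately have "d \<sim> e" using co by blast
    then show False
      using bull_freeD[OF bull, of d e c b a] V na \<open>a \<sim> e\<close> \<open>b \<sim> d\<close> \<open>c \<sim> d\<close> \<open>c \<sim> e\<close> sym by blast
  qed
  have coprime: "co.prime_on V"
    unfolding co.prime_on_def
  proof (intro allI impI)
    fix X assume X: "co.homogeneous X V \<and> 2 \<le> card X"
    have "(\<forall>x\<in>X. w \<sim> x) \<or> (\<forall>x\<in>X. \<not> w \<sim> x)" if w: "w \<in> V - X" for w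
    proof -
      have "(\<forall>x\<in>X. w \<noteq> x \<and> \<not> w \<sim> x) \<or> (\<forall>x\<in>X. \<not> (w \<noteq> x \<and> \<not> w \<sim> x))"
        using X w unfolding co.homogeneous_def by simp
      moreover have "w \<noteq> x" if "x \<in> X" for x using w that by blast
      ultimately show ?thesis by auto
    qed
    moreover have "X \<subseteq> V" using X unfolding co.homogeneous_def by simp
    ultimately have "homogeneous X V" unfolding homogeneous_def by simp
    then show "X = V" using X prime unfolding prime_on_def by blast
  qed
  let ?F = "range c"
  have FV: "?F \<subseteq> V" using cV by blast
  have "finite ?F" using FV fin finite_subset by blast
  moreover have "c 0 \<noteq> c 2" using hole7_neq[OF c, of 0] by auto
  ultimately have two: "2 \<le> card ?F" using card_mono[of ?F "{c 0, c 2}"] by simp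
  \<comment> \<open>Vertices at distance 2 on the cycle are adjacent in the complement, and 2
    generates the residues modulo 7, with inverse 4.\<close>
  have "co.reach ?F (c 0) (c (2 * m))" for m
  proof (induction m)
    case (Suc m)
    have "co.reach ?F (c (2 * m)) (c (2 * m + 2))"
      using hole7_neq[OF c, of "2 * m"] by (intro co.reach_edge) (auto simp: adj0)
    then have "co.reach ?F (c 0) (c (2 * m + 2))" by (rule co.reach_trans[OF Suc.IH])
    then show ?case by (simp add: add.commute)
  qed simp
  moreover have "c (2 * (4 * i)) = c i" for i
  proof -
    have "2 * (4 * i) = i + 7 * i" by simp
    then have "2 * (4 * i) mod 7 = i mod 7" by (simp only: mod_mult_self2)
    then show ?thesis using hole7_mod[OF c] by metis
  qed
  ultimately have r: "co.reach ?F (c 0) (c i)" for i by metis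
  have conn: "co.connected_on ?F"
    unfolding co.connected_on_def using co.reach_trans[OF co.reach_sym[OF r] r] by blast
  have zV: "z \<in> V - ?F" using z zc irrefl by blast
  have zF: "\<not> (z \<noteq> u \<and> \<not> z \<sim> u)" if "u \<in> ?F" for u using zc that by blast
  show False
  proof (rule co.prime_mixed_attachment[OF fin cobull coprime FV conn two zV zF])
    fix x y
    assume x: "x \<in> V - ?F" and y: "y \<in> V - ?F" and xy: "x \<noteq> y \<and> \<not> x \<sim> y"
      and yF: "\<And>u. u \<in> ?F \<Longrightarrow> \<not> (y \<noteq> u \<and> \<not> y \<sim> u)"
      and mixed: "\<exists>u\<in>?F. x \<noteq> u \<and> \<not> x \<sim> u" "\<exists>u\<in>?F. \<not> (x \<noteq> u \<and> \<not> x \<sim> u)"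
    have yc: "y \<sim> c i" for i using yF[of "c i"] y by blast
    \<comment> \<open>As \<open>y\<close> is complete to the cycle and not adjacent to
      \<open>x\<close>, this pattern gives the triangle of \<open>y\<close> and a cycle edge, with
      \<open>x\<close> attached at one end of the edge and a further cycle vertex at
      \<open>y\<close>. Each mixed attachment contains the pattern.\<close>
    have no_bull: False if "x \<sim> c (k + h)" "\<not> x \<sim> c (k + (h + 1))" "\<not> x \<sim> c (k + (h + 3))" for k h
    proof -
      have "c (k + h) \<sim> c (k + (h + 1))" "\<not> c (k + h) \<sim> c (k + (h + 3))" "\<not> c (k + (h + 1)) \<sim> c (k + (h + 3))"
        using adj[of "k + h" 0 1] adj[of "k + h" 0 3] adj[of "k + h" 1 3] by (simp_all add: add.assoc)
      then show False
        using bull_freeD[OF bull, of y "c (k + h)" "c (k + (h + 1))" "c (k + (h + 3))" x] that x y xy yc cV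
          sym[of y "c (k + (h + 1))"] sym[of x "c (k + h)"] sym[of y x] sym[of "c (k + (h + 1))" x]
          sym[of "c (k + (h + 3))" x] by blast
    qed
    from x have "x \<in> V" by blast
    from hole7_attachment[OF c bull C5 this] show False
    proof cases
      case 1
      then show ?thesis using mixed(2) x by blast
    next
      case 2
      then show ?thesis using mixed(1) by blast
    next
      case (3 k)
      then show ?thesis using no_bull[of k 0] cycD[OF 3, of 0] cycD[OF 3, of 1] cycD[OF 3, of 3] by simp
    next
      case (4 k)
      then show ?thesis using no_bull[of k 1] cycD[OF 4, of 1] cycD[OF 4, of 2] cycD[OF 4, of 4] by simp
    next
      case (5 k)
      then show ?thesis using no_bull[of k 1] cycD[OF 5, of 1] cycD[OF 5, of 2] cycD[OF 5, of 4] by simp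
    qed
  qed
qed

lemma hole7_dominated:
  assumes fin: "finite V" and bull: "bull_free V" and C5: "C5_free V" and P8: "P8_free V"
    and prime: "prime_on V" and c: "hole7 V c" and v: "v \<in> V" "\<And>i. \<not> v \<sim> c i"
  shows "\<exists>z\<in>V. V \<inter> nbrs v \<subset> V \<inter> nbrs z"
proof -
  note [simp del] = One_nat_def add_2_eq_Suc add_2_eq_Suc'
  note cV = hole7_in[OF c]
  have adj: "c (k + i) \<sim> c (k + j) \<longleftrightarrow> (i + 1) mod 7 = j mod 7 \<or> (j + 1) mod 7 = i mod 7" for k i j
    by (rule hole7_adj[OF c])
  have adj0: "c k \<sim> c (k + j) \<longleftrightarrow> 1 = j mod 7 \<or> (j + 1) mod 7 = 0"
     "c (k + j) \<sim> c k \<longleftrightarrow> 1 = j mod 7 \<or> (j + 1) mod 7 = 0" for k j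
    using adj[of k 0 j] adj[of k j 0] by auto
  have per: "c (k + (i + 7)) = c (k + i)" for k i
    using hole7_mod[OF c, of "k + (i + 7)"] hole7_mod[OF c, of "k + i"] by (simp add: add.assoc[symmetric])
  define A where "A = {u \<in> V. \<forall>i. \<not> u \<sim> c i}"
  have vA: "v \<in> A" using v by (simp add: A_def)
  have AV: "A \<subseteq> V" by (auto simp: A_def)
  \<comment> \<open>A single neighbor on the cycle starts a \<open>P_8\<close> consisting of
    \<open>y\<close>, \<open>n\<close> and six cycle vertices. Three consecutive neighbors give a
    bull with \<open>y\<close> attached at \<open>n\<close>.\<close>
  have type: "\<exists>k. cyc c n k {1, 6}" if n: "n \<in> V - A" and y: "y \<in> A" "n \<sim> y" for n y
  proof -
    have nV: "n \<in> V" and yV: "y \<in> V" and yc: "\<And>i. \<not> y \<sim> c i" using n y by (auto simp: A_def)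
    from hole7_attachment[OF c bull C5 nV] show ?thesis
    proof cases
      case 1
      then show ?thesis using n by (auto simp: A_def)
    next
      case 2
      then show ?thesis using hole7_no_complete[OF fin bull C5 prime c nV] by blast
    next
      case (3 k)
      let ?p = "case_nat n (\<lambda>i. c (k + i))"
      have p1: "induced_path V (Suc 5) ?p"
        by (rule induced_path_Cons[OF hole7_path[OF c]])
          (use cycD[OF 3] cycD[OF 3, of 0] nV in auto)
      have "induced_path V (Suc (Suc 5)) (case_nat y ?p)"
        by (rule induced_path_Cons[OF p1])
          (use sym[OF y(2)] yc yV in \<open>auto split: nat.splits\<close>)
      then show ?thesis using P8_free_short[OF P8] by fastforce
    next
      case (4 k)
      then show ?thesis by blast
    next
      case (5 k)
      have "n \<sim> c k" "n \<sim> c (k + 1)" "\<not> n \<sim> c (k + 2)"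
        using cycD[OF 5, of 0] cycD[OF 5, of 1] cycD[OF 5, of 2] by auto
      then have False
        using bull_freeD[OF bull, of n "c (k + 1)" "c k" y "c (k + 2)"] nV yV cV yc y(2)
          sym[of n "c k"] sym[of "c (k + 1)" y] sym[of "c k" y] by (auto simp: adj adj0)
      then show ?thesis ..
    qed
  qed
  \<comment> \<open>Otherwise \<open>y'\<close>, \<open>y\<close>, \<open>n\<close> and the five
    cycle vertices from \<open>k + 1\<close> to \<open>k + 5\<close> form a \<open>P_8\<close>.
    Hence the component of \<open>v\<close> in \<open>A\<close> is homogeneous, so it is
    \<open>v\<close> alone, and every neighbor of \<open>v\<close> has an attachment of the form
    \<open>{1, 6}\<close>.\<close>
  have spread: "n \<sim> y'" if n: "n \<in> V - A" and y: "y \<in> A" "n \<sim> y" and y': "y' \<in> A" "y \<sim> y'" for n y y'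
  proof (rule ccontr)
    assume ny': "\<not> n \<sim> y'"
    obtain k where k: "cyc c n k {1, 6}" using type[OF n y] by blast
    have V: "n \<in> V" "y \<in> V" "y' \<in> V" and yc: "\<And>i. \<not> y \<sim> c i" "\<And>i. \<not> y' \<sim> c i"
      using n y y' by (auto simp: A_def)
    let ?p = "case_nat n (\<lambda>i. c (k + 1 + i))"
    have p1: "induced_path V (Suc 4) ?p"
      by (rule induced_path_Cons[OF hole7_path[OF c]])
        (use cycD[OF k] cycD[OF k, of 1] V in \<open>auto simp: add.assoc\<close>)
    have p2: "induced_path V (Suc (Suc 4)) (case_nat y ?p)"
      by (rule induced_path_Cons[OF p1])
        (use sym[OF y(2)] yc V in \<open>auto split: nat.splits\<close>)
    have "induced_path V (Suc (Suc (Suc 4))) (case_nat y' (case_nat y ?p))"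
      by (rule induced_path_Cons[OF p2])
        (use sym[OF y'(2)] yc V ny' sym[of y' n] in \<open>auto split: nat.splits\<close>)
    then show False using P8_free_short[OF P8] by fastforce
  qed
  let ?Y = "component A v"
  have YA: "?Y \<subseteq> A" using vA by (rule component_subset)
  have "homogeneous ?Y V"
    unfolding homogeneous_def
  proof (intro conjI ballI)
    show "?Y \<subseteq> V" using YA AV by blast
    fix w assume w: "w \<in> V - ?Y"
    show "(\<forall>x\<in>?Y. w \<sim> x) \<or> (\<forall>x\<in>?Y. \<not> w \<sim> x)"
    proof (rule ccontr)
      assume "\<not> ?thesis"
      then obtain y y' where y: "y \<in> ?Y" "y' \<in> ?Y" "y \<sim> y'" "w \<sim> y" "\<not> w \<sim> y'"
        using mixed_edge[OF connected_on_component[OF vA]] by metis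
      have "w \<notin> A" using component_closed[OF y(1) vA _ sym[OF y(4)]] w by blast
      then show False using spread[of w y y'] y YA w by blast
    qed
  qed
  moreover have "?Y \<noteq> V"
  proof
    assume "?Y = V"
    then have "c 0 \<in> A" using cV YA by blast
    then show False using adj0[of 0 1] by (simp add: A_def)
  qed
  ultimately have "card ?Y < 2" using prime unfolding prime_on_def by (meson not_less)
  moreover have "finite ?Y" using YA AV fin by (meson finite_subset)
  ultimately have Yv: "u = v" if "u \<in> ?Y" for u
    using that card_le_Suc0_iff_eq[of ?Y] component_self[of v A] by auto
  have nt: "\<exists>k. cyc c u k {1, 6}" if u: "u \<in> V \<inter> nbrs v" for u
  proof -
    have vu: "v \<sim> u" using u by (simp add: nbrs_def)
    have "u \<notin> A"
    proof
      assume "u \<in> A"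
      then have "u \<in> ?Y" using component_closed[of v A v u] vA vu by simp
      then show False using Yv vu irrefl by blast
    qed
    then show ?thesis using type[of u v] u vA sym[OF vu] by blast
  qed
  \<comment> \<open>For these distances of centers \<open>x'\<close> is adjacent to
    \<open>c (k + 2)\<close>. Nonadjacent \<open>x\<close>, \<open>x'\<close> give the
    \<open>C_5\<close> through \<open>v\<close>, \<open>x\<close>, \<open>c (k + 1)\<close>,
    \<open>c (k + 2)\<close>, \<open>x'\<close>; adjacent ones form with \<open>v\<close> the
    triangle of a bull.\<close>
  have pair: False
    if x: "x \<in> V \<inter> nbrs v" "cyc c x k {1, 6}" and x': "x' \<in> V \<inter> nbrs v" "cyc c x' (k + j) {1, 6}"
      and j: "j = 1 \<or> j = 3" for x x' k j
  proof -
    have V: "x \<in> V" "x' \<in> V" "v \<sim> x" "v \<sim> x'" "x \<sim> v" "x' \<sim> v" using x x' sym by (auto simp: nbrs_def)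
    have X: "x \<sim> c (k + i) \<longleftrightarrow> i mod 7 \<in> {1, 6}" "c (k + i) \<sim> x \<longleftrightarrow> i mod 7 \<in> {1, 6}" for i
      using cycD[OF x(2)] sym by blast+
    have X': "x' \<sim> c (k + (j + i)) \<longleftrightarrow> i mod 7 \<in> {1, 6}" "c (k + (j + i)) \<sim> x' \<longleftrightarrow> i mod 7 \<in> {1, 6}" for i
      using cycD[OF x'(2), of i] sym by (auto simp: add.assoc)
    note vc = v(2)
    have cv: "\<not> c i \<sim> v" for i using v(2) sym by blast
    have e: "x' \<sim> c (k + 2)" "\<not> x' \<sim> c (k + 1)" "\<not> c (k + 6) \<sim> x'" "\<exists>m \<in> {2, 4}. x' \<sim> c (k + m)"
      using j X'(1)[of 1] X'(1)[of 0] X'(2)[of 5] X'(1)[of 6] X'(1)[of 5] X'(2)[of 3] per[of k 0] per[of k 1] per[of k 2] by auto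
    show False
    proof (cases "x \<sim> x'")
      case False
      then show False
        using C5_freeD[OF C5, of v x "c (k + 1)" "c (k + 2)" x'] V v(1) cV e X sym[of x' x] vc cv
          sym[of x' "c (k + 2)"] sym[of "c (k + 1)" x'] by (auto simp: adj)
    next
      case True
      \<comment> \<open>This is \<open>j + 1\<close>, the offset of a neighbor of \<open>x'\<close>
        that is adjacent neither to \<open>x\<close> nor to \<open>c (k + 6)\<close>.\<close>
      define m where "m = (if j = 1 then 2 else (4::nat))"
      have m: "x' \<sim> c (k + m)" "m = 2 \<or> m = 4"
        using j X'(1)[of 1] by (auto simp: m_def)
      moreover have "\<not> x' \<sim> c (k + 6)" using e(3) sym by blast
      ultimately show False
        using bull_freeD[OF bull, of x x' v "c (k + 6)" "c (k + m)"] V v(1) cV e X vc True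
        by (auto simp: adj)
    qed
  qed
  have cyc_shift: "cyc c x (k + j) M \<longleftrightarrow> cyc c x (k' + j') M" if "(k + j) mod 7 = (k' + j') mod 7" for x k k' j j' M
  proof -
    have "c (k + j + i) = c (k' + j' + i)" for i
    proof -
      have "(k + j + i) mod 7 = (k' + j' + i) mod 7"
        using that by (metis mod_add_left_eq)
      then show ?thesis using hole7_mod[OF c] by metis
    qed
    then show ?thesis by (simp add: cyc_def)
  qed
  have diff: "\<exists>j\<in>{0, 2, 5}. cyc c x' (k + j) {1, 6}"
    if x: "x \<in> V \<inter> nbrs v" "cyc c x k {1, 6}" and x': "x' \<in> V \<inter> nbrs v" for x x' k
  proof -
    obtain l where l: "cyc c x' l {1, 6}" using nt[OF x'] by blast
    \<comment> \<open>The difference \<open>l - k\<close> of the centers modulo 7. Differences 1 and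
      3 are excluded by \<open>pair\<close>, and 6 and 4 by \<open>pair\<close> with exchanged
      roles.\<close>
    define j where "j = (l + 6 * k) mod 7"
    have "j < 7" by (simp add: j_def)
    have "(k + j) mod 7 = (l + 7 * k) mod 7" unfolding j_def mod_add_right_eq by (simp add: algebra_simps)
    then have "(k + j) mod 7 = (l + 0) mod 7" by simp
    then have kj: "cyc c x' (k + j) {1, 6}" using cyc_shift[of k j l 0 x'] l by simp
    have "j \<noteq> 1" "j \<noteq> 3" using pair[OF x x' kj] by blast+
    moreover have "j \<noteq> 4"
    proof
      assume "j = 4"
      then have "cyc c x (k + j + 3) {1, 6}" using cyc_shift[of "k + j" 3 k 0 x] x(2) by simp
      then show False using pair[OF x' kj x(1)] by blast
    qed
    moreover have "j \<noteq> 6"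
    proof
      assume "j = 6"
      then have "cyc c x (k + j + 1) {1, 6}" using cyc_shift[of "k + j" 1 k 0 x] x(2) by simp
      then show False using pair[OF x' kj x(1)] by blast
    qed
    ultimately show ?thesis using less_7_cases[OF \<open>j < 7\<close>] kj by auto
  qed
  \<comment> \<open>If centers \<open>k\<close> and \<open>k + 2\<close> occur, a center
    \<open>k + 5\<close> would be at distance 3 from the second, so only these two occur, and
    \<open>c (k + 1)\<close> is adjacent to all the neighbors. If no two centers differ by 2, all
    coincide, and either cycle neighbor of the center will do.\<close>
  have "\<exists>m. V \<inter> nbrs v \<subseteq> nbrs (c m)"
  proof (cases "\<exists>x k. x \<in> V \<inter> nbrs v \<and> cyc c x k {1, 6} \<and> (\<exists>x' \<in> V \<inter> nbrs v. cyc c x' (k + 2) {1, 6})")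
    case True
    then obtain x k x' where x: "x \<in> V \<inter> nbrs v" "cyc c x k {1, 6}"
      and x': "x' \<in> V \<inter> nbrs v" "cyc c x' (k + 2) {1, 6}" by blast
    have "u \<in> nbrs (c (k + 1))" if u: "u \<in> V \<inter> nbrs v" for u
    proof -
      obtain j where j: "j \<in> {0, 2, 5}" "cyc c u (k + j) {1, 6}" using diff[OF x u] by blast
      have "j \<noteq> 5"
      proof
        assume "j = 5"
        then show False using pair[OF x' u, of 3] j by (simp add: add.assoc)
      qed
      then have "u \<sim> c (k + 1)"
        using j cycD[OF j(2), of 1] cycD[OF j(2), of 6] per[of k 1] by (auto simp: add.assoc)
      then show ?thesis using sym by (simp add: nbrs_def)
    qed
    then show ?thesis by blast
  next
    case False
    show ?thesis
    proof (cases "V \<inter> nbrs v = {}")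
      case nonempty: False
      then obtain x k where x: "x \<in> V \<inter> nbrs v" "cyc c x k {1, 6}" using nt by blast
      have "u \<in> nbrs (c (k + 1))" if u: "u \<in> V \<inter> nbrs v" for u
      proof -
        obtain j where j: "j \<in> {0, 2, 5}" "cyc c u (k + j) {1, 6}" using diff[OF x u] by blast
        have "j \<noteq> 2" using False x u j by blast
        moreover have "j \<noteq> 5"
        proof
          assume "j = 5"
          moreover from this have "cyc c x (k + 5 + 2) {1, 6}" using cyc_shift[of "k + 5" 2 k 0 x] x(2) by simp
          ultimately show False using False x u j by blast
        qed
        ultimately have "u \<sim> c (k + 1)" using j cycD[OF j(2), of 1] by auto
        then show ?thesis using sym by (simp add: nbrs_def)
      qed
      then show ?thesis by blast
    qed simp
  qed
  then obtain m where m: "V \<inter> nbrs v \<subseteq> nbrs (c m)" by blast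
  have "c (m + 1) \<in> nbrs (c m)" "c (m + 1) \<notin> nbrs v" using v(2) adj0 by (auto simp: nbrs_def)
  then have "V \<inter> nbrs v \<subset> V \<inter> nbrs (c m)" using m cV by blast
  then show ?thesis using cV by blast
qed

lemma induced_path_sub:
  assumes "induced_path V n p" "i + m \<le> n"
  shows "induced_path V m (\<lambda>t. p (i + t))"
  using assms unfolding induced_path_def by (auto intro!: inj_onI dest: inj_onD)

text \<open>Here \<open>k = 2\<close>, so \<open>F\<close> is not bipartite but
  \<open>F - {w}\<close> is. This yields an induced path of odd length between two neighbors of
  \<open>w\<close>; a shortest one closes through \<open>w\<close> to an induced odd cycle, whose
  length can only be 7.\<close>

lemma triangle_free_min_imperfect_hole7:
  assumes mi: "min_imperfect F" "\<And>K. K \<subseteq> F \<Longrightarrow> clq K \<Longrightarrow> card K \<le> k" "\<not> colorable F k"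
    and k3: "k < 3" and C5: "C5_free F" and P8: "P8_free F"
  shows "\<exists>c. hole7 F c"
proof -
  have k: "k = 2" using mi_two_le[OF mi] k3 by simp
  obtain w where w: "w \<in> F" using mi_nonempty[OF mi] by blast
  let ?W = "F - {w}"
  have "?W \<subset> F" using w by blast
  then obtain c where c: "coloring ?W 2 c"
    using mi_colorable_proper[OF mi] k unfolding colorable_def by blast
  define X where "X = {u \<in> ?W. w \<sim> u \<and> c u = 1}"
  let ?d = "kempe ?W c 1 0 X"
  have d: "coloring ?W 2 ?d" by (rule coloring_kempe[OF c]) (auto simp: X_def)
  \<comment> \<open>The exchange turns all neighbors of \<open>w\<close> in color 1 to color 0. If
    no neighbor acquired color 1 in return, \<open>w\<close> could take it.\<close>
  have "\<exists>u\<in>?W. w \<sim> u \<and> ?d u = 1"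
  proof (rule ccontr)
    assume "\<not> ?thesis"
    then have no: "?d u \<noteq> 1" if "u \<in> ?W" "w \<sim> u" for u using that by blast
    have "coloring F 2 (\<lambda>v. if v = w then 1 else ?d v)"
      unfolding coloring_def
    proof (intro conjI ballI impI)
      show "(if v = w then 1 else ?d v) < 2" if "v \<in> F" for v
        using d that unfolding coloring_def by auto
      fix u v assume uv: "u \<in> F" "v \<in> F" "u \<sim> v"
      have "u \<noteq> v" using uv irrefl by blast
      consider "u = w" "v \<in> ?W" | "v = w" "u \<in> ?W" | "u \<in> ?W" "v \<in> ?W"
        using uv \<open>u \<noteq> v\<close> by blast
      then show "(if u = w then 1 else ?d u) \<noteq> (if v = w then 1 else ?d v)"
      proof cases
        case 1
        then show ?thesis using no[of v] uv by auto
      next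
        case 2
        then show ?thesis using no[of u] sym[OF uv(3)] by auto
      next
        case 3
        moreover from this have "?d u \<noteq> ?d v" using d uv unfolding coloring_def by blast
        ultimately show ?thesis by simp
      qed
    qed
    then show False using mi(3) k by (auto simp: colorable_def)
  qed
  then obtain u where u: "u \<in> ?W" "w \<sim> u" "?d u = 1" by blast
  let ?T = "{v \<in> ?W. c v = 1 \<or> c v = 0}"
  \<comment> \<open>A neighbor with color 1 that was not exchanged would have belonged to
    \<open>X\<close>. So \<open>u\<close> lies on a Kempe chain starting in \<open>X\<close>, and
    its former color was 0.\<close>
  have r: "\<exists>a\<in>X. reach ?T a u"
  proof (rule ccontr)
    assume no: "\<not> ?thesis"
    then have "c u = 1" using u(3) unfolding kempe_def by (auto split: if_splits)
    then have "u \<in> X" using u by (simp add: X_def)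
    then show False using no reach_refl by blast
  qed
  then obtain a where a: "a \<in> X" "reach ?T a u" by blast
  have "?d u = (if c u = 1 then 0 else 1)" using r by (simp only: kempe_def if_True)
  then have cu: "c u \<noteq> 1" using u(3) by auto
  have "a \<in> ?T" using a by (simp add: X_def)
  from reach_induced_path[OF a(2) this] obtain n p
    where p: "induced_path ?T n p" "p 0 = a" "p n = u" .
  have "odd n" using induced_path_two_colors[OF c p(1)] p cu a(1) by (auto simp: X_def)
  moreover have "induced_path ?W n p" using p(1) by (rule induced_path_mono) blast
  moreover have "w \<sim> p 0" "w \<sim> p n" using p u a by (auto simp: X_def)
  ultimately have ex: "\<exists>n. odd n \<and> (\<exists>p. induced_path ?W n p \<and> w \<sim> p 0 \<and> w \<sim> p n)" by blast
  define P where "P n \<longleftrightarrow> odd n \<and> (\<exists>p. induced_path ?W n p \<and> w \<sim> p 0 \<and> w \<sim> p n)" for n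
  define m where "m = (LEAST n. P n)"
  have "\<exists>n. P n" using ex by (simp only: P_def)
  then have "P m" unfolding m_def by (rule LeastI_ex)
  then obtain q where q: "odd m" "induced_path ?W m q" "w \<sim> q 0" "w \<sim> q m" by (auto simp: P_def)
  have least: "m \<le> n" if "P n" for n unfolding m_def using that by (rule Least_le)
  \<comment> \<open>A further neighbor of \<open>w\<close> splits the odd path into two pieces, one
    of which is odd and shorter.\<close>
  have inner: "\<not> w \<sim> q i" if i: "0 < i" "i < m" for i
  proof
    assume wi: "w \<sim> q i"
    show False
    proof (cases "odd i")
      case True
      have "induced_path ?W i q" using induced_path_sub[OF q(2), of 0 i] i by simp
      then have "P i" using True q(3) wi by (auto simp: P_def)
      then show False using least i by fastforce
    next
      case False
      have "induced_path ?W (m - i) (\<lambda>t. q (i + t))" using i by (intro induced_path_sub[OF q(2)]) simp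
      moreover have "odd (m - i)" using False q(1) i by simp
      moreover have "i + (m - i) = m" using i by simp
      ultimately have "P (m - i)" using q(4) wi unfolding P_def by (intro conjI exI[of _ "\<lambda>t. q (i + t)"]) simp_all
      then show False using least i by fastforce
    qed
  qed
  have qF: "induced_path F m q" using q(2) by (rule induced_path_mono) blast
  have adj: "q i \<sim> q j \<longleftrightarrow> j = Suc i \<or> i = Suc j" if "i \<le> m" "j \<le> m" for i j
    using induced_path_adj[OF qF that] .
  have inF: "q i \<in> F" if "i \<le> m" for i using induced_path_in[OF qF that] .
  have wq: "w \<sim> q i \<longleftrightarrow> i = 0 \<or> i = m" if "i \<le> m" for i
    using inner[of i] that q(3,4) by (cases "i = 0"; cases "i = m") auto
  have qw: "q i \<sim> w \<longleftrightarrow> i = 0 \<or> i = m" if "i \<le> m" for i using wq[OF that] sym by blast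
  have "m < 7" using P8_free_short[OF P8 qF] .
  then have "m = 1 \<or> m = 3 \<or> m = 5" using q(1) by presburger
  then show ?thesis
  proof (elim disjE)
    assume m: "m = 1"
    have tri: "q 0 \<sim> q 1" "w \<sim> q 0" "w \<sim> q 1" using adj[of 0 1] wq[of 0] wq[of 1] m by auto
    then have "w \<noteq> q 0" "w \<noteq> q 1" "q 0 \<noteq> q 1" using irrefl by metis+
    moreover have "clq {w, q 0, q 1}"
      using tri sym[OF tri(1)] sym[OF tri(2)] sym[OF tri(3)] by (simp add: clq_def)
    ultimately have "3 \<le> k" using mi(2)[of "{w, q 0, q 1}"] inF[of 0] inF[of 1] w m by simp
    then show ?thesis using k3 by simp
  next
    assume m: "m = 3"
    have "False" using C5_freeD[OF C5, of w "q 0" "q 1" "q 2" "q 3"] w inF adj wq qw m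
      by (auto simp: eval_nat_numeral)
    then show ?thesis ..
  next
    assume m: "m = 5"
    define r where "r i = (if i mod 7 = 6 then w else q (i mod 7))" for i :: nat
    have less: "i mod 7 \<le> 5" if "i mod 7 \<noteq> 6" for i :: nat
      using that mod_less_divisor[of 7 i] by linarith
    have succ: "(i + 1) mod 7 = (if i mod 7 = 6 then 0 else i mod 7 + 1)" for i :: nat
      by (simp add: mod_Suc)
    have key: "(if a = 6 then w else q a) \<sim> (if b = 6 then w else q b) \<longleftrightarrow>
        (if a = 6 then 0 else a + 1) = b \<or> (if b = 6 then 0 else b + 1) = a"
      if ab: "a = 6 \<or> a \<le> 5" "b = 6 \<or> b \<le> 5" for a b :: nat
    proof (cases "a = 6"; cases "b = 6")
      assume "a = 6" "b = 6"
      then show ?thesis using irrefl by simp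
    next
      assume "a = 6" "b \<noteq> 6"
      then have "w \<sim> q b \<longleftrightarrow> b = 0 \<or> b = 5" using wq[of b] ab m by simp
      then show ?thesis using \<open>a = 6\<close> \<open>b \<noteq> 6\<close> by auto
    next
      assume "a \<noteq> 6" "b = 6"
      then have "q a \<sim> w \<longleftrightarrow> a = 0 \<or> a = 5" using qw[of a] ab m by simp
      then show ?thesis using \<open>a \<noteq> 6\<close> \<open>b = 6\<close> by auto
    next
      assume "a \<noteq> 6" "b \<noteq> 6"
      then have "q a \<sim> q b \<longleftrightarrow> b = Suc a \<or> a = Suc b" using adj[of a b] ab m by simp
      then show ?thesis using \<open>a \<noteq> 6\<close> \<open>b \<noteq> 6\<close> by auto
    qed
    have "hole7 F r"
      unfolding hole7_def
    proof (intro conjI allI)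
      show "r i \<in> F" for i using less[of i] inF m w by (simp add: r_def)
      show "r (i mod 7) = r i" for i by (simp add: r_def)
      fix i j
      show "r i \<sim> r j \<longleftrightarrow> (i + 1) mod 7 = j mod 7 \<or> (j + 1) mod 7 = i mod 7"
        unfolding succ r_def by (rule key) (use less in blast)+
    qed
    then show ?thesis by blast
  qed
qed

section \<open>Substitution into perfect graphs\<close>

lemma perfect_on_inj_image:
  assumes f: "inj_on f F" "\<And>u v. u \<in> F \<Longrightarrow> v \<in> F \<Longrightarrow> u \<sim> v \<longleftrightarrow> f u \<sim> f v"
    and perf: "perfect_on (f ` F)"
  shows "perfect_on F"
  unfolding perfect_on_def
proof (intro allI impI, elim conjE)
  fix U k assume U: "U \<subseteq> F" and bound: "\<forall>K\<subseteq>U. clq K \<longrightarrow> card K \<le> k"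
  have "card K \<le> k" if K: "K \<subseteq> f ` U" "clq K" for K
  proof -
    obtain L where L: "L \<subseteq> U" "K = f ` L" using K(1) by (meson subset_image_iff)
    have LF: "L \<subseteq> F" using L U by blast
    have inj: "inj_on f L" using f(1) LF by (rule inj_on_subset)
    have "clq L"
      unfolding clq_def
    proof (intro ballI impI)
      fix u v assume uv: "u \<in> L" "v \<in> L" "u \<noteq> v"
      then have "f u \<noteq> f v" using inj by (auto dest: inj_onD)
      then have "f u \<sim> f v" using K(2) L uv unfolding clq_def by blast
      then show "u \<sim> v" using f(2) uv LF by blast
    qed
    then show ?thesis using bound L card_image[OF inj] by simp
  qed
  moreover have "f ` U \<subseteq> f ` F" using U by blast
  ultimately have "colorable (f ` U) k" using perf unfolding perfect_on_def by blast
  then obtain c where "coloring (f ` U) k c" unfolding colorable_def by blast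
  then have "coloring U k (c \<circ> f)" using f(2) U unfolding coloring_def by (auto simp: subset_iff)
  then show "colorable U k" unfolding colorable_def by blast
qed

text \<open>Lovasz's substitution lemma; \<open>x\<close> need not lie in \<open>X\<close>. A
  minimal imperfect \<open>F\<close> inside \<open>A\<close> is prime and not contained in
  \<open>X\<close>, so it meets \<open>X\<close> in at most one vertex. Renaming that vertex to
  \<open>x\<close> embeds \<open>F\<close> into the perfect graph on
  \<open>insert x Y\<close>.\<close>

lemma perfect_on_substitute:
  assumes fin: "finite A" and XY: "A = Y \<union> X" "Y \<inter> X = {}" and hom: "homogeneous X A"
    and x: "x \<notin> Y" "\<And>y u. y \<in> Y \<Longrightarrow> u \<in> X \<Longrightarrow> y \<sim> u \<longleftrightarrow> y \<sim> x"
    and perf: "perfect_on X" "perfect_on (insert x Y)"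
  shows "perfect_on A"
proof (rule ccontr)
  assume "\<not> ?thesis"
  then obtain F where F: "F \<subseteq> A" "min_imperfect F" using not_perfect_imp_min_imperfect[OF fin] by blast
  have nF: "\<not> perfect_on F" using F by (simp add: min_imperfect_def)
  have "homogeneous (F \<inter> X) F" using hom F(1) unfolding homogeneous_def by blast
  moreover have "F \<inter> X \<noteq> F"
  proof
    assume "F \<inter> X = F"
    then have "perfect_on F" using perfect_on_mono[OF perf(1), of F] by blast
    with nF show False ..
  qed
  ultimately have "\<not> 2 \<le> card (F \<inter> X)"
    using min_imperfect_prime[OF F(2)] unfolding prime_on_def by blast
  moreover have "finite (F \<inter> X)" using F(1) fin finite_subset by blast
  ultimately have single: "u = v" if "u \<in> F \<inter> X" "v \<in> F \<inter> X" for u v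
    using that card_le_Suc0_iff_eq[of "F \<inter> X"] by simp
  define f where "f u = (if u \<in> X then x else u)" for u
  have in_cases: "u \<in> Y \<and> u \<notin> X \<or> u \<in> X \<and> u \<notin> Y" if "u \<in> F" for u using that F(1) XY by blast
  have "inj_on f F"
  proof (rule inj_onI)
    fix u v assume uv: "u \<in> F" "v \<in> F" "f u = f v"
    show "u = v"
    proof (cases "u \<in> X"; cases "v \<in> X")
      assume "u \<in> X" "v \<in> X"
      then show ?thesis using single[of u v] uv by simp
    qed (use uv in_cases[of u] in_cases[of v] x(1) in \<open>auto simp: f_def\<close>)
  qed
  moreover have "u \<sim> v \<longleftrightarrow> f u \<sim> f v" if uv: "u \<in> F" "v \<in> F" for u v
  proof (cases "u \<in> X"; cases "v \<in> X")
    assume "u \<in> X" "v \<in> X"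
    then show ?thesis using single[of u v] uv irrefl by (simp add: f_def)
  next
    assume "u \<in> X" "v \<notin> X"
    then have "v \<sim> u \<longleftrightarrow> v \<sim> x" using x(2)[of v u] in_cases uv by blast
    then show ?thesis using \<open>u \<in> X\<close> \<open>v \<notin> X\<close> sym by (auto simp: f_def)
  next
    assume "u \<notin> X" "v \<in> X"
    then show ?thesis using x(2)[of u v] in_cases[of u] uv by (simp add: f_def)
  qed (simp add: f_def)
  moreover have "f ` F \<subseteq> insert x Y" using in_cases by (auto simp: f_def)
  then have "perfect_on (f ` F)" using perfect_on_mono[OF perf(2)] by blast
  ultimately have "perfect_on F" by (rule perfect_on_inj_image)
  with nF show False ..
qed

section \<open>Perfect divisibility with weights\<close>

lemma prime_imp_perfect_nonneighbors:
  assumes fin: "finite V" and bull: "bull_free V" and C5: "C5_free V" and P8: "P8_free V"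
    and prime: "prime_on V" and v: "v \<in> V" and max: "\<And>z. z \<in> V \<Longrightarrow> card (V \<inter> nbrs z) \<le> card (V \<inter> nbrs v)"
  shows "perfect_on (V - nbrs v)"
proof (rule ccontr)
  assume "\<not> ?thesis"
  then obtain F where F: "F \<subseteq> V - nbrs v" "min_imperfect F"
    using not_perfect_imp_min_imperfect[of "V - nbrs v"] fin by blast
  obtain k where k: "\<And>K. K \<subseteq> F \<Longrightarrow> clq K \<Longrightarrow> card K \<le> k" "\<not> colorable F k"
    using min_imperfectE[OF F(2)] by blast
  note mi = F(2) k
  have FV: "F \<subseteq> V" using F by blast
  have finF: "finite F" using FV fin finite_subset by blast
  \<comment> \<open>The set considered contains \<open>v\<close> itself. In \<open>F\<close> the
    vertex \<open>v\<close> would be isolated, which makes \<open>F - {v}\<close>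
    homogeneous.\<close>
  have vF: "v \<notin> F"
  proof
    assume vF: "v \<in> F"
    have "stable {v}" using irrefl by (simp add: stable_def)
    then obtain K where K: "K \<subseteq> F - {v}" "card K = k"
      using mi_clique_avoiding[OF mi, of "{v}"] vF by blast
    have "homogeneous (F - {v}) F" using F(1) unfolding homogeneous_def nbrs_def by blast
    moreover have "2 \<le> card (F - {v})"
      using card_mono[of "F - {v}" K] K finF mi_two_le[OF mi] by simp
    ultimately have "F - {v} = F" using min_imperfect_prime[OF F(2)] unfolding prime_on_def by blast
    then show False using vF by blast
  qed
  have anti: "\<not> v \<sim> u" if "u \<in> F" for u using F(1) that by (auto simp: nbrs_def)
  show False
  proof (cases "3 \<le> k")
    case True
    then show False
      using prime_no_anticomplete_min_imperfect[OF fin bull C5 P8 prime FV mi True, of v] v vF anti by blast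
  next
    case False
    then obtain c where c: "hole7 F c"
      using triangle_free_min_imperfect_hole7[OF mi] C5_free_mono[OF C5 FV] P8_free_mono[OF P8 FV] by auto
    have "\<not> v \<sim> c i" for i using anti hole7_in[OF c] by blast
    then obtain z where z: "z \<in> V" "V \<inter> nbrs v \<subset> V \<inter> nbrs z"
      using hole7_dominated[OF fin bull C5 P8 prime hole7_mono[OF c FV] v] by blast
    then have "card (V \<inter> nbrs v) < card (V \<inter> nbrs z)" using fin by (intro psubset_card_mono) auto
    then show False using max[OF z(1)] by simp
  qed
qed

text \<open>For finite \<open>V\<close> this says that the maximum weight of a clique drops when
  \<open>A\<close> is removed. The case \<open>K = {}\<close> demands a clique of positive
  weight.\<close>

definition weight_divisible :: "'a set \<Rightarrow> ('a \<Rightarrow> nat) \<Rightarrow> bool" where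
  "weight_divisible V w \<longleftrightarrow> (\<exists>A\<subseteq>V. perfect_on A \<and>
     (\<forall>K\<subseteq>V - A. clq K \<longrightarrow> (\<exists>L\<subseteq>V. clq L \<and> sum w K < sum w L)))"

lemma clq_insert:
  assumes "clq K" "\<And>u. u \<in> K \<Longrightarrow> v \<sim> u"
  shows "clq (insert v K)"
  using assms sym[of v] unfolding clq_def by auto

lemma clq_Un:
  assumes "clq K" "clq L" "\<And>u v. u \<in> K \<Longrightarrow> v \<in> L \<Longrightarrow> u \<sim> v"
  shows "clq (K \<union> L)"
  unfolding clq_def
proof (intro ballI impI)
  fix u v assume "u \<in> K \<union> L" "v \<in> K \<union> L" "u \<noteq> v"
  then consider "u \<in> K" "v \<in> K" | "u \<in> K" "v \<in> L" | "u \<in> L" "v \<in> K" | "u \<in> L" "v \<in> L" by blast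
  then show "u \<sim> v"
    using assms(1,2) assms(3)[of u v] sym[OF assms(3)[of v u]] \<open>u \<noteq> v\<close> unfolding clq_def by cases blast+
qed

text \<open>Let \<open>A\<close> solve the contracted graph and \<open>B\<close> solve
  \<open>X\<close>. If \<open>A\<close> avoids \<open>x\<close>, it also solves \<open>V\<close>:
  for a clique meeting \<open>X\<close>, that part is replaced by \<open>x\<close>, which loses no
  weight. If \<open>A\<close> contains \<open>x\<close>, substitute \<open>B\<close> for
  \<open>x\<close>: a clique that meets \<open>X\<close> outside \<open>B\<close> gains weight when
  its part in \<open>X\<close> is exchanged for a heavier clique of \<open>X\<close>.\<close>

lemma weight_divisible_contract:
  assumes fin: "finite V"
    and hom: "homogeneous X V" and x: "x \<in> X"
    and M: "M \<subseteq> X" "clq M" "\<And>K. K \<subseteq> X \<Longrightarrow> clq K \<Longrightarrow> sum w K \<le> sum w M"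
    and divX: "weight_divisible X w"
    and divY: "weight_divisible (insert x (V - X)) (w(x := sum w M))"
  shows "weight_divisible V w"
proof -
  let ?w = "w(x := sum w M)" and ?V = "insert x (V - X)"
  have XV: "X \<subseteq> V" using hom by (simp add: homogeneous_def)
  have finsub: "finite K" if "K \<subseteq> V" for K using that fin finite_subset by blast
  have homD: "y \<sim> u \<longleftrightarrow> y \<sim> x" if "y \<in> V - X" "u \<in> X" for y u
    using hom that x unfolding homogeneous_def by blast
  have wX: "sum ?w K = sum w K" if "x \<notin> K" for K using that by (intro sum.cong) auto
  \<comment> \<open>Putting \<open>M\<close> in place of \<open>x\<close> turns a clique of the
    contracted graph into one of \<open>V\<close> of the same weight.\<close>
  have lift: "\<exists>L'\<subseteq>V. clq L' \<and> sum w L' = sum ?w L" if L: "L \<subseteq> ?V" "clq L" for L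
  proof (cases "x \<in> L")
    case False
    then show ?thesis using L wX[OF False] by (intro exI[of _ L]) auto
  next
    case True
    let ?R = "L - {x}"
    have R: "?R \<subseteq> V - X" "clq ?R" using L clq_mono by auto
    have cross: "u \<sim> v" if "u \<in> ?R" "v \<in> M" for u v
    proof -
      have "u \<sim> x" using L(2) True that unfolding clq_def by blast
      then show ?thesis using homD[of u v] that R M by blast
    qed
    have "clq (?R \<union> M)" using R(2) M(2) cross by (rule clq_Un)
    moreover have "?R \<union> M \<subseteq> V" using R M XV by blast
    moreover have "sum w (?R \<union> M) = sum w ?R + sum w M"
      using R M XV by (intro sum.union_disjoint finsub) auto
    moreover have "sum ?w L = sum ?w ?R + sum w M"
      using True L finite_subset[OF L(1)] fin by (simp add: sum.remove[of L x])
    moreover have "sum ?w ?R = sum w ?R" by (rule wX) simp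
    ultimately show ?thesis by (intro exI[of _ "?R \<union> M"]) simp
  qed
  obtain B where B: "B \<subseteq> X" "perfect_on B"
    and B': "\<And>K. K \<subseteq> X - B \<Longrightarrow> clq K \<Longrightarrow> \<exists>L\<subseteq>X. clq L \<and> sum w K < sum w L"
    using divX unfolding weight_divisible_def by blast
  obtain A where A: "A \<subseteq> ?V" "perfect_on A"
    and A': "\<And>K. K \<subseteq> ?V - A \<Longrightarrow> clq K \<Longrightarrow> \<exists>L\<subseteq>?V. clq L \<and> sum ?w K < sum ?w L"
    using divY unfolding weight_divisible_def by blast
  have outside: "\<exists>L\<subseteq>V. clq L \<and> sum w K < sum w L" if K: "K \<subseteq> ?V - A" "clq K" "x \<notin> K" for K
    using A'[OF K(1,2)] wX[OF K(3)] lift by metis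
  \<comment> \<open>A vertex of \<open>K\<close> outside \<open>X\<close> has a neighbor in
    \<open>K \<inter> X\<close>, so by homogeneity it is adjacent to all of
    \<open>X\<close>.\<close>
  have swap: "clq ((K - X) \<union> L)" if K: "K \<subseteq> V" "clq K" "K \<inter> X \<noteq> {}" and L: "L \<subseteq> X" "clq L" for K L
  proof -
    have "u \<sim> v" if "u \<in> K - X" "v \<in> L" for u v
    proof -
      obtain t where t: "t \<in> K" "t \<in> X" using K(3) by blast
      moreover have "u \<noteq> t" using that t by blast
      ultimately have "u \<sim> t" using K(2) that(1) unfolding clq_def by blast
      then show ?thesis using homD[of u t] homD[of u v] that t K(1) L(1) by blast
    qed
    then show ?thesis using clq_mono[OF K(2), of "K - X"] L(2) by (intro clq_Un) auto
  qed
  have split: "sum w ((K - X) \<union> L) = sum w (K - X) + sum w L" if "K \<subseteq> V" "L \<subseteq> X" for K L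
    using that XV by (intro sum.union_disjoint finsub) auto
  have split': "sum w K = sum w (K - X) + sum w (K \<inter> X)" if "K \<subseteq> V" for K
    using sum.Int_Diff[OF finsub[OF that], of w X] by simp
  show ?thesis
  proof (cases "x \<in> A")
    case False
    have "\<exists>L\<subseteq>V. clq L \<and> sum w K < sum w L" if K: "K \<subseteq> V - A" "clq K" for K
    proof (cases "K \<inter> X = {}")
      case True
      then show ?thesis using outside[of K] K x by blast
    next
      case nonempty: False
      have KV: "K \<subseteq> V" using K by blast
      let ?K = "(K - X) \<union> {x}"
      have "clq ?K" using swap[OF KV K(2) nonempty, of "{x}"] x by (simp add: clq_def)
      moreover have "?K \<subseteq> ?V - A" using K False by blast
      ultimately obtain L where L: "L \<subseteq> ?V" "clq L" "sum ?w ?K < sum ?w L" using A' by blast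
      have "sum ?w ?K = sum ?w (K - X) + sum w M"
        using finsub[of "K - X"] KV x by (subst sum.union_disjoint) auto
      moreover have "sum ?w (K - X) = sum w (K - X)" using x by (intro wX) simp
      moreover have "sum w (K \<inter> X) \<le> sum w M" using clq_mono[OF K(2), of "K \<inter> X"] by (intro M(3)) auto
      ultimately have "sum w K < sum ?w L" using split'[OF KV] L(3) by simp
      then show ?thesis using lift[OF L(1,2)] by metis
    qed
    moreover have "A \<subseteq> V" using A(1) False by blast
    ultimately show ?thesis unfolding weight_divisible_def using A(2) by blast
  next
    case True
    let ?A = "(A - {x}) \<union> B"
    have AV: "?A \<subseteq> V" using A(1) B(1) XV by blast
    have "perfect_on ?A"
    proof (rule perfect_on_substitute[of _ "A - {x}" B x])
      show "finite ?A" using AV by (rule finsub)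
      show "(A - {x}) \<inter> B = {}" using A(1) B(1) by blast
      show "homogeneous B ?A" using A(1) B(1) hom unfolding homogeneous_def by blast
      show "y \<sim> u \<longleftrightarrow> y \<sim> x" if "y \<in> A - {x}" "u \<in> B" for y u using homD[of y u] that A(1) B(1) by blast
      show "perfect_on (insert x (A - {x}))" using A(2) True by (simp add: insert_absorb)
    qed (use B in auto)
    moreover have "\<exists>L\<subseteq>V. clq L \<and> sum w K < sum w L" if K: "K \<subseteq> V - ?A" "clq K" for K
    proof (cases "K \<inter> X = {}")
      case True
      then show ?thesis using outside[of K] K x by blast
    next
      case nonempty: False
      have KV: "K \<subseteq> V" using K by blast
      have "K \<inter> X \<subseteq> X - B" using K(1) by blast
      then obtain L where L: "L \<subseteq> X" "clq L" "sum w (K \<inter> X) < sum w L"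
        using B' clq_mono[OF K(2), of "K \<inter> X"] by blast
      have "clq ((K - X) \<union> L)" by (rule swap[OF KV K(2) nonempty L(1,2)])
      moreover have "sum w K < sum w ((K - X) \<union> L)" using split[OF KV L(1)] split'[OF KV] L(3) by simp
      moreover have "(K - X) \<union> L \<subseteq> V" using KV L(1) XV by blast
      ultimately show ?thesis by blast
    qed
    ultimately show ?thesis unfolding weight_divisible_def using AV by blast
  qed
qed

theorem weight_divisible_P8_C5_bull_free:
  assumes "finite V" "V \<noteq> {}" "bull_free V" "C5_free V" "P8_free V" "\<And>v. v \<in> V \<Longrightarrow> 0 < w v"
  shows "weight_divisible V w"
  using assms
proof (induction "card V" arbitrary: V w rule: less_induct)
  case less
  note fin = less.prems(1)
  show ?case
  proof (cases "prime_on V")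
    case True
    let ?deg = "\<lambda>v. card (V \<inter> nbrs v)"
    have "finite (?deg ` V)" "?deg ` V \<noteq> {}" using fin less.prems(2) by auto
    from Max_in[OF this] obtain v where v: "v \<in> V" "Max (?deg ` V) = ?deg v" by auto
    have max: "?deg z \<le> ?deg v" if "z \<in> V" for z
      using Max_ge[of "?deg ` V" "?deg z"] fin that v(2) by simp
    have "perfect_on (V - nbrs v)"
      by (rule prime_imp_perfect_nonneighbors[OF fin less.prems(3-5) True v(1) max])
    moreover have "\<exists>L\<subseteq>V. clq L \<and> sum w K < sum w L" if K: "K \<subseteq> V - (V - nbrs v)" "clq K" for K
    proof -
      have "v \<notin> K" using K(1) v(1) irrefl by (auto simp: nbrs_def)
      moreover have "finite K" using K(1) fin finite_subset by blast
      ultimately have "sum w K < sum w (insert v K)" using less.prems(6)[OF v(1)] by simp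
      moreover have "clq (insert v K)" using K by (intro clq_insert) (auto simp: nbrs_def)
      moreover have "insert v K \<subseteq> V" using K(1) v(1) by blast
      ultimately show ?thesis by blast
    qed
    ultimately show ?thesis unfolding weight_divisible_def by blast
  next
    case False
    then obtain X where X: "homogeneous X V" "2 \<le> card X" "X \<noteq> V" unfolding prime_on_def by blast
    have XV: "X \<subset> V" using X by (auto simp: homogeneous_def)
    have finX: "finite X" using XV fin finite_subset by blast
    obtain x where x: "x \<in> X" using X(2) by fastforce
    have "\<forall>K. K \<subseteq> X \<and> clq K \<longrightarrow> sum w K < Suc (sum w X)"
      using finX by (simp add: sum_mono2 less_Suc_eq_le)
    moreover have "{} \<subseteq> X \<and> clq {}" by (simp add: clq_def)
    ultimately have "\<exists>M. (M \<subseteq> X \<and> clq M) \<and> (\<forall>K. K \<subseteq> X \<and> clq K \<longrightarrow> sum w K \<le> sum w M)"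
      using ex_has_greatest_nat[of "\<lambda>K. K \<subseteq> X \<and> clq K" "{}" "sum w" "Suc (sum w X)"] by simp
    then obtain M where M: "M \<subseteq> X" "clq M" "\<And>K. K \<subseteq> X \<Longrightarrow> clq K \<Longrightarrow> sum w K \<le> sum w M" by blast
    have "w x \<le> sum w M" using M(3)[of "{x}"] x by (simp add: clq_def)
    then have Mpos: "0 < sum w M" using less.prems(6)[of x] x XV by fastforce
    \<comment> \<open>Contraction amounts to deleting \<open>X - {x}\<close>, so the contracted
      graph is an induced subgraph and inherits the forbidden subgraphs.\<close>
    let ?V = "insert x (V - X)"
    have V': "?V \<subseteq> V" using x XV by blast
    have "card ?V = card V - card X + 1"
      using fin finX x XV by (simp add: card_Diff_subset less_imp_le)
    then have smaller: "card ?V < card V" using X(2) card_mono[OF fin, of X] XV by auto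
    show ?thesis
    proof (rule weight_divisible_contract[OF fin X(1) x M])
      show "weight_divisible X w"
      proof (rule less.hyps)
        show "card X < card V" using XV fin by (rule psubset_card_mono[rotated])
        show "bull_free X" "C5_free X" "P8_free X"
          using less.prems(3-5) XV bull_free_mono C5_free_mono P8_free_mono by blast+
        show "0 < w u" if "u \<in> X" for u using less.prems(6) that XV by blast
      qed (use finX x in auto)
      show "weight_divisible ?V (w(x := sum w M))"
      proof (rule less.hyps[OF smaller])
        show "bull_free ?V" "C5_free ?V" "P8_free ?V"
          using less.prems(3-5) V' bull_free_mono C5_free_mono P8_free_mono by blast+
        show "0 < (w(x := sum w M)) u" if "u \<in> ?V" for u using less.prems(6)[of u] that V' Mpos by auto
      qed (use fin in auto)
    qed
  qed
qed

end

section \<open>Graphs as symmetric digraphs\<close>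

lemma (in graph) dominates_simple_graph: "simple_graph (\<lambda>u v. u \<rightarrow>\<^bsub>G\<^esub> v)"
proof
  show "v \<rightarrow>\<^bsub>G\<^esub> u" if "u \<rightarrow>\<^bsub>G\<^esub> v" for u v
    using sym_arcs that by (rule arcs_ends_symmetric)
  show "\<not> u \<rightarrow>\<^bsub>G\<^esub> u" for u
    using no_loops by (auto simp: arcs_ends_conv)
qed

lemma induced_subgraph_dominates:
  assumes "induced_subgraph H G" "u \<in> verts H" "v \<in> verts H"
  shows "u \<rightarrow>\<^bsub>H\<^esub> v \<longleftrightarrow> u \<rightarrow>\<^bsub>G\<^esub> v"
proof -
  have "tail G = tail H" "head G = head H" and
    "arcs H = {e \<in> arcs G. tail G e \<in> verts H \<and> head G e \<in> verts H}"
    using assms(1) unfolding induced_subgraph_def subgraph_def compatible_def by auto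
  then show ?thesis using assms(2,3) by (auto simp: arcs_ends_conv image_iff)
qed

lemma induced_subgraph_restrict:
  assumes "wf_digraph G" "A \<subseteq> verts G"
  shows "induced_subgraph (G \<restriction> A) G"
  using assms by (intro wf_digraph.induced_induce) auto

text \<open>An arc is sent to the pair of indices of its ends. This is injective because there are
  no parallel arcs, and onto the arcs of the pattern by the adjacency condition.\<close>

lemma induced_copy:
  fixes p :: "nat \<Rightarrow> 'a" and R :: "nat rel"
  assumes wf: "wf_digraph G" and nomulti: "nomulti_digraph G"
    and p: "inj_on p {..<n}" "p ` {..<n} \<subseteq> verts G" and R: "R \<subseteq> {..<n} \<times> {..<n}"
    and adj: "\<And>i j. i < n \<Longrightarrow> j < n \<Longrightarrow> p i \<rightarrow>\<^bsub>G\<^esub> p j \<longleftrightarrow> (i, j) \<in> R \<union> R\<inverse>"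
  shows "\<not> induced_free (undirected {..<n} R) G"
proof -
  define H where "H = G \<restriction> (p ` {..<n})"
  have ind: "induced_subgraph H G" unfolding H_def using wf p(2) by (rule induced_subgraph_restrict)
  then have wfH: "wf_digraph H" by (simp add: induced_subgraph_def subgraph_def)
  have vH: "verts H = p ` {..<n}" by (simp add: H_def)
  have tH: "tail H = tail G" "head H = head G" by (simp_all add: H_def)
  have sub: "arcs H \<subseteq> arcs G" using ind by (simp add: induced_subgraph_def subgraph_def)
  define q where "q = the_inv_into {..<n} p"
  have qp: "q (p i) = i" if "i < n" for i unfolding q_def using p(1) that by (simp add: the_inv_into_f_f)
  define f :: "('a, 'b, nat, nat \<times> nat) digraph_isomorphism" where
    "f = \<lparr>iso_verts = q, iso_arcs = (\<lambda>e. (q (tail G e), q (head G e))), iso_head = snd, iso_tail = fst\<rparr>"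
  have ends: "\<exists>i<n. \<exists>j<n. tail G e = p i \<and> head G e = p j" if "e \<in> arcs H" for e
    using wf_digraph.tail_in_verts[OF wfH that] wf_digraph.head_in_verts[OF wfH that] vH tH by auto
  have arc: "(q (tail G e), q (head G e)) \<in> R \<union> R\<inverse>" if e: "e \<in> arcs H" for e
  proof -
    obtain i j where ij: "i < n" "j < n" "tail G e = p i" "head G e = p j" using ends[OF e] by blast
    then have "p i \<rightarrow>\<^bsub>G\<^esub> p j" using e sub by (force simp: arcs_ends_conv)
    then show ?thesis using adj ij qp by simp
  qed
  have arc': "(i, j) \<in> (\<lambda>e. (q (tail G e), q (head G e))) ` arcs H" if "(i, j) \<in> R \<union> R\<inverse>" for i j
  proof -
    have ij: "i < n" "j < n" using that R by auto
    then have "p i \<rightarrow>\<^bsub>H\<^esub> p j" using induced_subgraph_dominates[OF ind] vH adj that by blast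
    then obtain e where "e \<in> arcs H" "tail H e = p i" "head H e = p j" by (auto simp: arcs_ends_conv)
    then show ?thesis using qp ij tH by force
  qed
  have "pre_digraph.digraph_isomorphism H f"
    unfolding pre_digraph.digraph_isomorphism_def
  proof (intro conjI ballI)
    show "inj_on (iso_verts f) (verts H)"
      using qp by (auto simp: f_def vH intro!: inj_onI)
    show "inj_on (iso_arcs f) (arcs H)"
    proof (rule inj_onI)
      fix e e' assume e: "e \<in> arcs H" "e' \<in> arcs H" "iso_arcs f e = iso_arcs f e'"
      then have "tail G e = tail G e'" "head G e = head G e'"
        using ends[OF e(1)] ends[OF e(2)] qp by (auto simp: f_def)
      then have "arc_to_ends G e = arc_to_ends G e'" by (simp add: arc_to_ends_def)
      then show "e = e'" using nomulti_digraph.no_multi_arcs[OF nomulti] e(1,2) sub by blast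
    qed
  qed (simp_all add: wfH f_def tH)
  moreover have "undirected {..<n} R = app_iso f H"
  proof (rule pre_digraph.equality)
    show "verts (undirected {..<n} R) = verts (app_iso f H)"
      using qp by (force simp: undirected_def f_def vH)
    show "arcs (undirected {..<n} R) = arcs (app_iso f H)"
      using arc arc' by (auto simp: undirected_def f_def)
  qed (simp_all add: undirected_def f_def)
  ultimately have "digraph_iso H (undirected {..<n} R)" unfolding digraph_iso_def by blast
  with ind show ?thesis unfolding induced_free_def by blast
qed

lemma less_5_cases: "(i::nat) < 5 \<Longrightarrow> i = 0 \<or> i = 1 \<or> i = 2 \<or> i = 3 \<or> i = 4"
  by linarith

context graph begin

interpretation sg: simple_graph "\<lambda>u v. u \<rightarrow>\<^bsub>G\<^esub> v"
  by (rule dominates_simple_graph)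

lemma P8_free_verts:
  assumes "induced_free (path_graph 8) G"
  shows "sg.P8_free (verts G)"
  unfolding sg.P8_free_def
proof
  assume "\<exists>p. sg.induced_path (verts G) 7 p"
  then obtain p where p: "sg.induced_path (verts G) 7 p" by blast
  have set: "{..<8::nat} = {..7}" by auto
  have "\<not> induced_free (undirected {..<8} {(i, Suc i) | i. Suc i < 8}) G"
  proof (rule induced_copy[OF wf_digraph nomulti_digraph, of p])
    show "inj_on p {..<8}" "p ` {..<8} \<subseteq> verts G"
      using p unfolding sg.induced_path_def set by auto
    show "p i \<rightarrow>\<^bsub>G\<^esub> p j \<longleftrightarrow> (i, j) \<in> {(i, Suc i) | i. Suc i < 8} \<union> {(i, Suc i) | i. Suc i < 8}\<inverse>"
      if "i < 8" "j < 8" for i j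
      using sg.induced_path_adj[OF p, of i j] that by auto
  qed auto
  with assms show False by (simp add: path_graph_def)
qed

lemma C5_free_verts:
  assumes "induced_free (cycle_graph 5) G"
  shows "sg.C5_free (verts G)"
  unfolding sg.C5_free_def
proof (intro notI, elim bexE conjE)
  fix a b c d e
  assume V: "a \<in> verts G" "b \<in> verts G" "c \<in> verts G" "d \<in> verts G" "e \<in> verts G"
    and E: "a \<rightarrow>\<^bsub>G\<^esub> b" "b \<rightarrow>\<^bsub>G\<^esub> c" "c \<rightarrow>\<^bsub>G\<^esub> d" "d \<rightarrow>\<^bsub>G\<^esub> e" "e \<rightarrow>\<^bsub>G\<^esub> a"
    and N: "\<not> a \<rightarrow>\<^bsub>G\<^esub> c" "\<not> b \<rightarrow>\<^bsub>G\<^esub> d" "\<not> c \<rightarrow>\<^bsub>G\<^esub> e" "\<not> d \<rightarrow>\<^bsub>G\<^esub> a" "\<not> e \<rightarrow>\<^bsub>G\<^esub> b"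
  have sE: "b \<rightarrow>\<^bsub>G\<^esub> a" "c \<rightarrow>\<^bsub>G\<^esub> b" "d \<rightarrow>\<^bsub>G\<^esub> c" "e \<rightarrow>\<^bsub>G\<^esub> d" "a \<rightarrow>\<^bsub>G\<^esub> e"
    using E sg.sym by blast+
  have sN: "\<not> c \<rightarrow>\<^bsub>G\<^esub> a" "\<not> d \<rightarrow>\<^bsub>G\<^esub> b" "\<not> e \<rightarrow>\<^bsub>G\<^esub> c" "\<not> a \<rightarrow>\<^bsub>G\<^esub> d" "\<not> b \<rightarrow>\<^bsub>G\<^esub> e"
    using N sg.sym by blast+
  note adj = E N sE sN sg.irrefl
  have dist: "a \<noteq> b" "a \<noteq> c" "a \<noteq> d" "a \<noteq> e" "b \<noteq> c" "b \<noteq> d" "b \<noteq> e" "c \<noteq> d" "c \<noteq> e" "d \<noteq> e"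
    using adj by metis+
  define p where "p i = [a, b, c, d, e] ! i" for i
  have p: "p 0 = a" "p 1 = b" "p (Suc 0) = b" "p 2 = c" "p 3 = d" "p 4 = e" by (simp_all add: p_def)
  let ?R = "{(i, Suc i mod 5) | i. i < 5}"
  have R: "?R = {(0, 1), (1, 2), (2, 3), (3, 4), (4, 0)}"
  proof
    show "?R \<subseteq> {(0, 1), (1, 2), (2, 3), (3, 4), (4, 0)}"
    proof
      fix x assume "x \<in> ?R"
      then obtain i where i: "x = (i, Suc i mod 5)" "i < 5" by blast
      from less_5_cases[OF i(2)] show "x \<in> {(0, 1), (1, 2), (2, 3), (3, 4), (4, 0)}"
        by (elim disjE) (simp_all add: i(1))
    qed
  qed simp
  have "\<not> induced_free (undirected {..<5} ?R) G"
  proof (rule induced_copy[OF wf_digraph nomulti_digraph, of p])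
    show "inj_on p {..<5}"
      by (rule inj_onI) (use less_5_cases dist p in \<open>auto dest!: less_5_cases\<close>)
    show "p ` {..<5} \<subseteq> verts G" using V p by (auto dest!: less_5_cases)
    show "p i \<rightarrow>\<^bsub>G\<^esub> p j \<longleftrightarrow> (i, j) \<in> ?R \<union> ?R\<inverse>" if "i < 5" "j < 5" for i j
      using less_5_cases[OF that(1)] less_5_cases[OF that(2)] unfolding R
      by (elim disjE) (simp_all add: p adj)
  qed auto
  with assms show False by (simp add: cycle_graph_def)
qed

lemma bull_free_verts:
  assumes "induced_free bull G"
  shows "sg.bull_free (verts G)"
  unfolding sg.bull_free_def
proof (intro notI, elim bexE conjE)
  fix a b c d e
  assume V: "a \<in> verts G" "b \<in> verts G" "c \<in> verts G" "d \<in> verts G" "e \<in> verts G"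
    and E: "a \<rightarrow>\<^bsub>G\<^esub> b" "b \<rightarrow>\<^bsub>G\<^esub> c" "c \<rightarrow>\<^bsub>G\<^esub> a" "a \<rightarrow>\<^bsub>G\<^esub> d" "b \<rightarrow>\<^bsub>G\<^esub> e"
    and N: "\<not> a \<rightarrow>\<^bsub>G\<^esub> e" "\<not> b \<rightarrow>\<^bsub>G\<^esub> d" "\<not> c \<rightarrow>\<^bsub>G\<^esub> d" "\<not> c \<rightarrow>\<^bsub>G\<^esub> e" "\<not> d \<rightarrow>\<^bsub>G\<^esub> e"
  have sE: "b \<rightarrow>\<^bsub>G\<^esub> a" "c \<rightarrow>\<^bsub>G\<^esub> b" "a \<rightarrow>\<^bsub>G\<^esub> c" "d \<rightarrow>\<^bsub>G\<^esub> a" "e \<rightarrow>\<^bsub>G\<^esub> b"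
    using E sg.sym by blast+
  have sN: "\<not> e \<rightarrow>\<^bsub>G\<^esub> a" "\<not> d \<rightarrow>\<^bsub>G\<^esub> b" "\<not> d \<rightarrow>\<^bsub>G\<^esub> c" "\<not> e \<rightarrow>\<^bsub>G\<^esub> c" "\<not> e \<rightarrow>\<^bsub>G\<^esub> d"
    using N sg.sym by blast+
  note adj = E N sE sN sg.irrefl
  have dist: "a \<noteq> b" "a \<noteq> c" "a \<noteq> d" "a \<noteq> e" "b \<noteq> c" "b \<noteq> d" "b \<noteq> e" "c \<noteq> d" "c \<noteq> e" "d \<noteq> e"
    using adj by metis+
  define p where "p i = [a, b, c, d, e] ! i" for i
  have p: "p 0 = a" "p 1 = b" "p (Suc 0) = b" "p 2 = c" "p 3 = d" "p 4 = e" by (simp_all add: p_def)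
  have "\<not> induced_free (undirected {..<5::nat} {(0, 1), (1, 2), (2, 0), (0, 3), (1, 4)}) G"
  proof (rule induced_copy[OF wf_digraph nomulti_digraph, of p])
    show "inj_on p {..<5}"
      by (rule inj_onI) (use less_5_cases dist p in \<open>auto dest!: less_5_cases\<close>)
    show "p ` {..<5} \<subseteq> verts G" using V p by (auto dest!: less_5_cases)
    show "p i \<rightarrow>\<^bsub>G\<^esub> p j \<longleftrightarrow>
        (i, j) \<in> {(0, 1), (1, 2), (2, 0), (0, 3), (1, 4)} \<union> {(0, 1), (1, 2), (2, 0), (0, 3), (1, 4)}\<inverse>"
      if "i < 5" "j < 5" for i j
      using less_5_cases[OF that(1)] less_5_cases[OF that(2)]
      by (elim disjE) (simp_all add: p adj)
  qed auto
  with assms show False by (simp add: bull_def)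
qed

end

section \<open>Clique and chromatic numbers of induced subgraphs in terms of one adjacency
  relation\<close>

context simple_graph begin

context
  fixes H :: "('a, 'b) pre_digraph"
  assumes fin: "finite (verts H)"
    and dom: "\<And>u v. u \<in> verts H \<Longrightarrow> v \<in> verts H \<Longrightarrow> u \<rightarrow>\<^bsub>H\<^esub> v \<longleftrightarrow> u \<sim> v"
begin

lemma clique_iff_clq: "clique H K \<longleftrightarrow> K \<subseteq> verts H \<and> clq K"
  unfolding clique_def clq_def using dom by blast

lemma proper_coloring_iff_coloring: "proper_coloring H k c \<longleftrightarrow> coloring (verts H) k c"
  unfolding proper_coloring_def coloring_def using dom by blast

lemma finite_clique_cards: "finite {card K | K. clique H K}"
proof (rule finite_subset)
  show "{card K | K. clique H K} \<subseteq> {..card (verts H)}"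
    using fin card_mono unfolding clique_iff_clq by auto
qed simp

lemma clique_card_le: "K \<subseteq> verts H \<Longrightarrow> clq K \<Longrightarrow> card K \<le> clique_number H"
  unfolding clique_number_def using finite_clique_cards clique_iff_clq by (intro Max_ge) blast+

lemma clique_number_attained:
  obtains K where "K \<subseteq> verts H" "clq K" "card K = clique_number H"
proof -
  have "clique H {}" by (simp add: clique_def)
  then have "{card K | K. clique H K} \<noteq> {}" by blast
  from Max_in[OF finite_clique_cards this] obtain K where "clique H K" "card K = clique_number H"
    unfolding clique_number_def by auto
  with that show thesis unfolding clique_iff_clq by blast
qed

text \<open>Perfection bounds the number of colors from above; from below, a maximum clique needs
  distinct colors.\<close>

lemma chromatic_number_eq:
  assumes "perfect_on (verts H)"
  shows "chromatic_number H = clique_number H"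
  unfolding chromatic_number_def
proof (rule Least_equality)
  have "colorable (verts H) (clique_number H)"
    using assms clique_card_le unfolding perfect_on_def by blast
  then show "\<exists>c. proper_coloring H (clique_number H) c"
    unfolding colorable_def proper_coloring_iff_coloring .
next
  fix k assume "\<exists>c. proper_coloring H k c"
  then obtain c where c: "coloring (verts H) k c" unfolding proper_coloring_iff_coloring by blast
  obtain K where K: "K \<subseteq> verts H" "clq K" "card K = clique_number H" by (rule clique_number_attained)
  have "card (c ` K) = clique_number H"
    using card_image[OF coloring_inj_on_clq[OF c K(1,2)]] K(3) by simp
  moreover have "c ` K \<subseteq> {..<k}" using c K(1) unfolding coloring_def by blast
  ultimately show "clique_number H \<le> k" using card_mono[of "{..<k}" "c ` K"] by simp
qed

end

lemma perfect_if_perfect_on: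
  assumes fin: "finite (verts G)"
    and dom: "\<And>u v. u \<in> verts G \<Longrightarrow> v \<in> verts G \<Longrightarrow> u \<rightarrow>\<^bsub>G\<^esub> v \<longleftrightarrow> u \<sim> v"
    and perf: "perfect_on (verts G)"
  shows "perfect G"
  unfolding perfect_def
proof (intro allI impI)
  fix H assume H: "induced_subgraph H G"
  then have sub: "verts H \<subseteq> verts G" by (simp add: induced_subgraph_def subgraph_def)
  have "finite (verts H)" using sub fin finite_subset by blast
  moreover have "u \<rightarrow>\<^bsub>H\<^esub> v \<longleftrightarrow> u \<sim> v" if "u \<in> verts H" "v \<in> verts H" for u v
    using induced_subgraph_dominates[OF H that] dom sub that by blast
  moreover have "perfect_on (verts H)" using perf sub by (rule perfect_on_mono)
  ultimately show "chromatic_number H = clique_number H" by (rule chromatic_number_eq)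
qed

end

theorem theorem1p3:
  fixes G :: "('a, 'b) pre_digraph"
  assumes "graph G"
    and "induced_free (path_graph 8) G"
    and "induced_free (cycle_graph 5) G"
    and "induced_free bull G"
  shows "perfectly_divisible G"
  unfolding perfectly_divisible_def
proof (intro allI impI, elim conjE)
  interpret G: graph G by (rule assms(1))
  interpret sg: simple_graph "\<lambda>u v. u \<rightarrow>\<^bsub>G\<^esub> v" by (rule G.dominates_simple_graph)
  fix H assume H: "induced_subgraph H G" "verts H \<noteq> {}"
  let ?V = "verts H"
  have VG: "?V \<subseteq> verts G" using H(1) by (simp add: induced_subgraph_def subgraph_def)
  have finV: "finite ?V" using VG by (rule finite_subset) simp
  have wfH: "wf_digraph H" using H(1) by (simp add: induced_subgraph_def subgraph_def)
  have dom: "u \<rightarrow>\<^bsub>H\<^esub> v \<longleftrightarrow> u \<rightarrow>\<^bsub>G\<^esub> v" if "u \<in> ?V" "v \<in> ?V" for u v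
    using H(1) that by (rule induced_subgraph_dominates)
  \<comment> \<open>With unit weights, the weight of a clique is its cardinality.\<close>
  have "sg.weight_divisible ?V (\<lambda>_. 1)"
  proof (rule sg.weight_divisible_P8_C5_bull_free[OF finV H(2)])
    show "sg.bull_free ?V" "sg.C5_free ?V" "sg.P8_free ?V"
      using sg.bull_free_mono[OF G.bull_free_verts[OF assms(4)] VG]
        sg.C5_free_mono[OF G.C5_free_verts[OF assms(3)] VG]
        sg.P8_free_mono[OF G.P8_free_verts[OF assms(2)] VG] by blast+
  qed simp
  then obtain A where A: "A \<subseteq> ?V" "sg.perfect_on A"
    and less: "\<And>K. K \<subseteq> ?V - A \<Longrightarrow> sg.clq K \<Longrightarrow> \<exists>L\<subseteq>?V. sg.clq L \<and> card K < card L"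
    unfolding sg.weight_divisible_def by auto
  have restrict: "u \<rightarrow>\<^bsub>H \<restriction> U\<^esub> v \<longleftrightarrow> u \<rightarrow>\<^bsub>G\<^esub> v" if "U \<subseteq> ?V" "u \<in> U" "v \<in> U" for U u v
    using induced_subgraph_dominates[OF induced_subgraph_restrict[OF wfH that(1)], of u v] that dom[of u v]
    by auto
  have "perfect (H \<restriction> A)"
    by (rule sg.perfect_if_perfect_on) (use A restrict finite_subset[OF A(1) finV] in auto)
  moreover have "clique_number (H \<restriction> (?V - A)) < clique_number H"
  proof -
    obtain K where K: "K \<subseteq> ?V - A" "sg.clq K" "card K = clique_number (H \<restriction> (?V - A))"
      by (rule sg.clique_number_attained[of "H \<restriction> (?V - A)"]) (use finV restrict[of "?V - A"] in auto)
    obtain L where L: "L \<subseteq> ?V" "sg.clq L" "card K < card L" using less[OF K(1,2)] by blast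
    have "card L \<le> clique_number H" using finV dom L(1,2) by (rule sg.clique_card_le)
    then show ?thesis using K(3) L(3) by simp
  qed
  ultimately show "\<exists>A B. A \<union> B = ?V \<and> A \<inter> B = {} \<and> perfect (H \<restriction> A) \<and>
      clique_number (H \<restriction> B) < clique_number H"
    using A(1) by (intro exI[of _ A] exI[of _ "?V - A"]) auto
qed

end
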